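(* Let $\mathcal A\subset\mathcal S(V)^G$ be a standard algebra of type $\mathbb A$ which is finitely generated over $H^0(V,\mathcal O^G)$ and which preserves the vector space $\mathfrak O^G$. Then $\mathcal A$ is a rational Galois order.
   Context: Fix $n\ge 2$ and positive integers $n_1,\dots,n_n$. $V=\mathbb C^{\sum_k n_k}=\{v=(v_{ki}) : 1\le k\le n,\ 1\le i\le n_k\}$, an additive group, and $G=S_{n_1}\times\cdots\times S_{n_n}$ acts on $V$ by permuting, for each $k$, the coordinates $v_{k1},\dots,v_{kn_k}$. $\delta^{k1}\in V$ is the vector with entry $1$ in position $(k,1)$ and $0$ elsewhere; for $a\in\mathbb C$, $\xi^a_k=a\delta^{k1}$. $\mathcal O$ and $\mathcal M$ are the sheaves of holomorphic (or polynomial) and meromorphic (or rational) functions on $V$, with germs $\mathcal O_x,\mathcal M_x$. $\phi_\xi$ is translation $x\mapsto x+\xi$, acting on functions/germs by $\phi_\xi(f)(x)=f(x-\xi)$. $\mathcal S(V)$ is the skew-group ring of finite sums $\sum_i f_i\phi_{\xi_i}$, $f_i$ meromorphic (or rational) on $V$, $\xi_i\in V$, with product $f\phi_\xi\circ f'\phi_{\xi'}=f\phi_\xi(f')\phi_{\xi+\xi'}$; it acts on $\bigoplus_x\mathcal M_x$ by $f\phi_\xi:\mathcal M_x\to\mathcal M_{x+\xi}$, $F\mapsto f\phi_\xi(F)$. $G$ acts by $(g\cdot f)(x)=f(g^{-1}\cdot x)$ and $g\cdot(f\phi_\xi)=(g\cdot f)\phi_{g\cdot\xi}$; $\mathcal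 S(V)^G$ is the ring of invariants. $\mathfrak O^G=\bigoplus_{\bar x\in V/G}\mathcal O^G_{\bar x}$ with $\mathcal O^G_{\bar x}=\big(\bigoplus_{x'\in\bar x}\mathcal O_{x'}\big)^G$; $\mathcal A$ preserves $\mathfrak O^G$ if $A(\mathfrak O^G)\subset\mathfrak O^G$ for all $A\in\mathcal A$. $H^0(V,\mathcal O^G)$ is the algebra of global $G$-invariant functions on $V$. An element of $\mathcal S(V)^G$ is standard if it has the form $\sum_{g\in G}g\cdot(f\phi_{\xi^a_k})$ with $a\in\mathbb C$, $1\le k\le n$, $f$ a meromorphic (or rational) function. A subalgebra of $\mathcal S(V)^G$ is standard of type $\mathbb A$ if it is generated by linear combinations of standard elements. "Finitely generated over $H^0(V,\mathcal O^G)$" means that the algebra contains $H^0(V,\mathcal O^G)$ and is generated by it together with finitely many elements. For a character $\chi:G\to\mathbb C^\times$, $d_\chi=\prod_{H}\gamma_H^{a_H}$, the product over all hyperplanes $H\subset V$ fixed by a reflection $\sigma_H\in G$, where $\gamma_H\in V^*$ has kernel $H$ and $a_H$ is the minimal non-negative integer with $\chi(\sigma_H)=\det(\sigma_H^* )^{a_H}$. For $X=\sum_i f_i\phi_{\xi_i}$ (distinct $\xi_i$), $d_\chi X$ is holomorphic in $V$ if all $d_\chi f_i$ are holomorphic on $V$. A rational Galois order is a subalgebra of $\mathcal S(V)^G$ that contains $H^0(V,\mathcal O^G)$ and is generated over it by finitely many elements $X\in\mathcal S(V)^G$ such that for each of them there is a character $\chi$ of $G$ with $d_\chi X$ holomorphic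 in $V$. *)

theory Defs
  imports
    "HOL-Analysis.Analysis"
    "HOL-Library.Poly_Mapping"
    "HOL-Combinatorics.Perm"
begin

section \<open>Holomorphic and polynomial functions on \<open>V\<close>\<close>

text \<open>
  The space \<open>V\<close> is \<open>complex ^ 'i\<close>, where the finite index type \<open>'i\<close> is identified with the set of
  index pairs \<open>(k, i)\<close>, \<open>1 \<le> k \<le> n\<close>, \<open>1 \<le> i \<le> N k\<close>, by a bijection \<open>lab\<close> (see \<open>labelling\<close>).

  Everything is done for both readings of the word ``function'': holomorphic and
  meromorphic functions, or polynomial and rational functions.  Rational functions (and their
  germs) are treated as particular meromorphic functions (and germs).
\<close>

datatype setting = Analytic | Algebraic

definition complex_functional :: "(complex ^ 'i \<Rightarrow> complex) \<Rightarrow> bool" where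
  "complex_functional D \<longleftrightarrow> Vector_Spaces.linear (*s) (*) D"

definition holo_on :: "(complex ^ 'i::finite \<Rightarrow> complex) \<Rightarrow> (complex ^ 'i) set \<Rightarrow> bool" where
  "holo_on f U \<longleftrightarrow> (\<forall>z\<in>U. \<exists>D. complex_functional D \<and> (f has_derivative D) (at z))"

inductive_set poly_funs :: "(complex ^ 'i::finite \<Rightarrow> complex) set" where
  const: "(\<lambda>_. c) \<in> poly_funs"
| coord: "(\<lambda>z. z $ i) \<in> poly_funs"
| add: "p \<in> poly_funs \<Longrightarrow> q \<in> poly_funs \<Longrightarrow> (\<lambda>z. p z + q z) \<in> poly_funs"
| mult: "p \<in> poly_funs \<Longrightarrow> q \<in> poly_funs \<Longrightarrow> (\<lambda>z. p z * q z) \<in> poly_funs"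

lemma complex_functional_iff:
  "complex_functional D \<longleftrightarrow> (\<forall>x y. D (x + y) = D x + D y) \<and> (\<forall>c x. D (c *s x) = c * D x)"
proof -
  have "vector_space ((*) :: complex \<Rightarrow> complex \<Rightarrow> complex)"
    by unfold_locales (auto simp: algebra_simps)
  moreover have "vector_space ((*s) :: complex \<Rightarrow> complex ^ 'b \<Rightarrow> complex ^ 'b)"
    by unfold_locales (auto simp: vec_eq_iff algebra_simps)
  ultimately show ?thesis
    unfolding complex_functional_def Vector_Spaces.linear_def module_hom_def module_hom_axioms_def
      vector_space_def module_def
    by (auto simp: vector_space_def)
qed

lemma holo_on_const: "holo_on (\<lambda>_. c) U"
  unfolding holo_on_def
  by (auto intro!: exI[of _ "\<lambda>_. 0"] simp: complex_functional_iff)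

lemma holo_on_add: "holo_on f U \<Longrightarrow> holo_on g U \<Longrightarrow> holo_on (\<lambda>z. f z + g z) U"
  unfolding holo_on_def
proof
  fix z assume "\<forall>z\<in>U. \<exists>D. complex_functional D \<and> (f has_derivative D) (at z)"
    "\<forall>z\<in>U. \<exists>D. complex_functional D \<and> (g has_derivative D) (at z)" "z \<in> U"
  then obtain D E where "complex_functional D" "(f has_derivative D) (at z)"
    "complex_functional E" "(g has_derivative E) (at z)" by blast
  then show "\<exists>D. complex_functional D \<and> ((\<lambda>z. f z + g z) has_derivative D) (at z)"
    by (intro exI[of _ "\<lambda>h. D h + E h"])
       (auto simp: complex_functional_iff algebra_simps intro!: derivative_eq_intros)
qed

lemma holo_on_mult: "holo_on f U \<Longrightarrow> holo_on g U \<Longrightarrow> holo_on (\<lambda>z. f z * g z) U"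
  unfolding holo_on_def
proof
  fix z assume "\<forall>z\<in>U. \<exists>D. complex_functional D \<and> (f has_derivative D) (at z)"
    "\<forall>z\<in>U. \<exists>D. complex_functional D \<and> (g has_derivative D) (at z)" "z \<in> U"
  then obtain D E where "complex_functional D" "(f has_derivative D) (at z)"
    "complex_functional E" "(g has_derivative E) (at z)" by blast
  then show "\<exists>D. complex_functional D \<and> ((\<lambda>z. f z * g z) has_derivative D) (at z)"
    by (intro exI[of _ "\<lambda>h. f z * E h + D h * g z"])
       (auto simp: complex_functional_iff algebra_simps intro!: derivative_eq_intros)
qed

lemma holo_on_subset: "holo_on f U \<Longrightarrow> W \<subseteq> U \<Longrightarrow> holo_on f W"
  unfolding holo_on_def by blast

lemma holo_on_continuous: "holo_on f U \<Longrightarrow> continuous_on U f"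
  unfolding holo_on_def
  by (meson continuous_at_imp_continuous_on has_derivative_continuous)

lemma holo_on_compose_affine:
  assumes "holo_on f U"
    and T: "\<And>z. (T has_derivative L) (at z)" "\<And>x y. L (x + y) = L x + L y"
      "\<And>c x. L (c *s x) = c *s L x"
  shows "holo_on (\<lambda>z. f (T z)) (T -` U)"
  unfolding holo_on_def
proof
  fix z assume "z \<in> T -` U"
  then obtain D where D: "complex_functional D" "(f has_derivative D) (at (T z))"
    using assms(1) unfolding holo_on_def by auto
  have "((\<lambda>z. f (T z)) has_derivative (\<lambda>h. D (L h))) (at z)"
    using diff_chain_at[OF T(1)[of z] D(2)] by (simp add: o_def)
  then show "\<exists>D. complex_functional D \<and> ((\<lambda>z. f (T z)) has_derivative D) (at z)"
    using D(1) T(2,3) by (intro exI[of _ "\<lambda>h. D (L h)"]) (auto simp: complex_functional_iff)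
qed


section \<open>Agreement of functions near a point\<close>

text \<open>
  Meromorphic functions are handled through total functions whose values on a nowhere dense set
  are irrelevant; \<open>f\<close> and \<open>g\<close> represent the same germ at \<open>x\<close> if they agree on a dense open
  subset of a neighbourhood of \<open>x\<close>.
\<close>

definition agree_near :: "'a::topological_space \<Rightarrow> ('a \<Rightarrow> 'b) \<Rightarrow> ('a \<Rightarrow> 'b) \<Rightarrow> bool" where
  "agree_near x f g \<longleftrightarrow> x \<in> interior (closure (interior {z. f z = g z}))"

lemma agree_near_iff:
  "agree_near x f g \<longleftrightarrow>
     (\<exists>U D. open U \<and> x \<in> U \<and> open D \<and> U \<subseteq> closure D \<and> (\<forall>z\<in>D. f z = g z))"
proof
  assume "agree_near x f g"
  then show "\<exists>U D. open U \<and> x \<in> U \<and> open D \<and> U \<subseteq> closure D \<and> (\<forall>z\<in>D. f z = g z)"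
    unfolding agree_near_def
    by (intro exI[of _ "interior (closure (interior {z. f z = g z}))"]
        exI[of _ "interior {z. f z = g z}"])
       (auto simp: interior_subset dest: subsetD[OF interior_subset])
next
  assume "\<exists>U D. open U \<and> x \<in> U \<and> open D \<and> U \<subseteq> closure D \<and> (\<forall>z\<in>D. f z = g z)"
  then obtain U D where *: "open U" "x \<in> U" "open D" "U \<subseteq> closure D" "\<forall>z\<in>D. f z = g z"
    by blast
  then have "D \<subseteq> interior {z. f z = g z}" by (intro interior_maximal) auto
  then have "U \<subseteq> closure (interior {z. f z = g z})" using *(4) closure_mono by blast
  then show "agree_near x f g"
    unfolding agree_near_def using *(1,2) interior_maximal by blast
qed

lemma agree_nearI:
  "open U \<Longrightarrow> x \<in> U \<Longrightarrow> open D \<Longrightarrow> U \<subseteq> closure D \<Longrightarrow> (\<And>z. z \<in> D \<Longrightarrow> f z = g z) \<Longrightarrow> agree_near x f g"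
  unfolding agree_near_iff by blast

lemma dense_open_Int:
  assumes "open U1" "open A" "open B" "U1 \<subseteq> closure A" "open U2" "U2 \<subseteq> closure B"
  shows "U1 \<inter> U2 \<subseteq> closure (A \<inter> B)"
proof
  fix z assume z: "z \<in> U1 \<inter> U2"
  have "W \<inter> (A \<inter> B) \<noteq> {}" if W: "open W" "z \<in> W" for W
  proof -
    have "open (W \<inter> U1 \<inter> U2)" "z \<in> W \<inter> U1 \<inter> U2" using W z assms by auto
    moreover have "z \<in> closure A" using z assms(4) by auto
    ultimately have "A \<inter> (W \<inter> U1 \<inter> U2) \<noteq> {}"
      unfolding closure_iff_nhds_not_empty by blast
    then obtain y where y: "y \<in> A" "y \<in> W" "y \<in> U1" "y \<in> U2" by auto
    have "open (W \<inter> A)" "y \<in> W \<inter> A" "y \<in> closure B" using y W assms by auto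
    then have "B \<inter> (W \<inter> A) \<noteq> {}" unfolding closure_iff_nhds_not_empty by blast
    then show ?thesis by auto
  qed
  then show "z \<in> closure (A \<inter> B)" unfolding closure_iff_nhds_not_empty by blast
qed

lemma agree_near_combine:
  assumes "agree_near x f f'" "agree_near x g g'"
    and "\<And>z. f z = f' z \<Longrightarrow> g z = g' z \<Longrightarrow> h z = h' z"
  shows "agree_near x h h'"
proof -
  obtain U D U' D' where *: "open U" "x \<in> U" "open D" "U \<subseteq> closure D" "\<forall>z\<in>D. f z = f' z"
    "open U'" "x \<in> U'" "open D'" "U' \<subseteq> closure D'" "\<forall>z\<in>D'. g z = g' z"
    using assms(1,2) unfolding agree_near_iff by blast
  show ?thesis
    by (rule agree_nearI[of "U \<inter> U'" _ "D \<inter> D'"])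
       (use * assms(3) dense_open_Int[of U D D' U'] in auto)
qed

lemma agree_near_refl [simp]: "agree_near x f f"
  by (rule agree_nearI[of UNIV _ UNIV]) auto

lemma agree_near_sym: "agree_near x f g \<Longrightarrow> agree_near x g f"
  by (erule agree_near_combine[OF _ agree_near_refl]) auto

lemma agree_near_trans: "agree_near x f g \<Longrightarrow> agree_near x g h \<Longrightarrow> agree_near x f h"
  by (erule (1) agree_near_combine) auto

lemma agree_near_compose:
  assumes "agree_near (T x) f g" "continuous_on UNIV T" "continuous_on UNIV S"
    and TS: "\<And>z. T (S z) = z" "\<And>z. S (T z) = z"
  shows "agree_near x (\<lambda>z. f (T z)) (\<lambda>z. g (T z))"
proof -
  obtain U D where *: "open U" "T x \<in> U" "open D" "U \<subseteq> closure D" "\<forall>z\<in>D. f z = g z"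
    using assms(1) unfolding agree_near_iff by blast
  have "T -` U \<subseteq> closure (T -` D)"
  proof
    fix z assume z: "z \<in> T -` U"
    have "(T -` D) \<inter> W \<noteq> {}" if W: "open W" "z \<in> W" for W
    proof -
      have "open (S -` W)" using assms(3) W(1) by (simp add: continuous_on_open_vimage)
      moreover have "T z \<in> S -` W" "T z \<in> closure D" using W z * TS by auto
      ultimately have "D \<inter> (S -` W) \<noteq> {}" unfolding closure_iff_nhds_not_empty by blast
      then obtain y where "y \<in> D" "S y \<in> W" by auto
      then have "S y \<in> (T -` D) \<inter> W" using TS by auto
      then show ?thesis by blast
    qed
    then show "z \<in> closure (T -` D)" unfolding closure_iff_nhds_not_empty by blast
  qed
  moreover have "open (T -` U)" "open (T -` D)"
    using * assms(2) by (auto simp: continuous_on_open_vimage)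
  ultimately show ?thesis
    by (intro agree_nearI[of "T -` U" _ "T -` D"]) (use * in auto)
qed


section \<open>Meromorphic functions\<close>

definition mero_at :: "complex ^ 'i::finite \<Rightarrow> (complex ^ 'i \<Rightarrow> complex) \<Rightarrow> bool" where
  "mero_at x f \<longleftrightarrow> (\<exists>U g h. open U \<and> x \<in> U \<and> holo_on g U \<and> holo_on h U \<and>
     interior {z\<in>U. h z = 0} = {} \<and> agree_near x f (\<lambda>z. g z / h z))"

lemma mero_at_cong:
  assumes "agree_near x f g" "mero_at x f" shows "mero_at x g"
  using assms unfolding mero_at_def by (meson agree_near_sym agree_near_trans)

lemma mero_at_const: "mero_at x (\<lambda>_. c)"
  unfolding mero_at_def
  by (intro exI[of _ UNIV] exI[of _ "\<lambda>_. c"] exI[of _ "\<lambda>_. 1"]) (auto simp: holo_on_const)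

lemma nonzero_open_dense:
  fixes h :: "'a::topological_space \<Rightarrow> 'b::real_normed_vector"
  assumes "open U" "continuous_on U h" "interior {z\<in>U. h z = 0} = {}"
  shows "open {z\<in>U. h z \<noteq> 0}" "U \<subseteq> closure {z\<in>U. h z \<noteq> 0}"
proof -
  have "{z\<in>U. h z \<noteq> 0} = U \<inter> h -` (- {0})" by auto
  then show "open {z\<in>U. h z \<noteq> 0}"
    using continuous_open_preimage[OF assms(2,1), of "- {0}"] by auto
  show "U \<subseteq> closure {z\<in>U. h z \<noteq> 0}"
  proof
    fix z assume z: "z \<in> U"
    have "{z\<in>U. h z \<noteq> 0} \<inter> W \<noteq> {}" if W: "open W" "z \<in> W" for W
    proof
      assume "{z\<in>U. h z \<noteq> 0} \<inter> W = {}"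
      then have "U \<inter> W \<subseteq> {z\<in>U. h z = 0}" by auto
      then have "U \<inter> W \<subseteq> interior {z\<in>U. h z = 0}"
        using assms(1) W by (intro interior_maximal) auto
      then show False using z W assms(3) by auto
    qed
    then show "z \<in> closure {z\<in>U. h z \<noteq> 0}" unfolding closure_iff_nhds_not_empty by blast
  qed
qed

lemma mero_at_binop:
  fixes x :: "complex ^ 'i::finite"
  assumes "mero_at x f1" "mero_at x f2"
    and num: "\<And>g1 h1 g2 h2 (U :: (complex ^ 'i) set). holo_on g1 U \<Longrightarrow> holo_on h1 U \<Longrightarrow> holo_on g2 U \<Longrightarrow> holo_on h2 U \<Longrightarrow>
        \<exists>k. holo_on k U \<and>
          (\<forall>z\<in>U. h1 z \<noteq> 0 \<longrightarrow> h2 z \<noteq> 0 \<longrightarrow> F (g1 z / h1 z) (g2 z / h2 z) = k z / (h1 z * h2 z))"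
  shows "mero_at x (\<lambda>z. F (f1 z) (f2 z))"
proof -
  obtain U1 g1 h1 where 1: "open U1" "x \<in> U1" "holo_on g1 U1" "holo_on h1 U1"
     "interior {z\<in>U1. h1 z = 0} = {}" "agree_near x f1 (\<lambda>z. g1 z / h1 z)"
    using assms(1) unfolding mero_at_def by blast
  obtain U2 g2 h2 where 2: "open U2" "x \<in> U2" "holo_on g2 U2" "holo_on h2 U2"
     "interior {z\<in>U2. h2 z = 0} = {}" "agree_near x f2 (\<lambda>z. g2 z / h2 z)"
    using assms(2) unfolding mero_at_def by blast
  define U where "U = U1 \<inter> U2"
  define D where "D = {z\<in>U1. h1 z \<noteq> 0} \<inter> {z\<in>U2. h2 z \<noteq> 0}"
  note d1 = nonzero_open_dense[OF 1(1) holo_on_continuous[OF 1(4)] 1(5)]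
  note d2 = nonzero_open_dense[OF 2(1) holo_on_continuous[OF 2(4)] 2(5)]
  have U: "open U" "x \<in> U" using 1 2 by (auto simp: U_def)
  have D: "open D" "U \<subseteq> closure D"
    using d1 d2 dense_open_Int[OF 1(1) d1(1) d2(1) d1(2) 2(1) d2(2)] by (auto simp: U_def D_def)
  have h: "holo_on g1 U" "holo_on h1 U" "holo_on g2 U" "holo_on h2 U"
    using 1 2 by (auto simp: U_def intro: holo_on_subset)
  obtain k where k: "holo_on k U"
    "\<forall>z\<in>U. h1 z \<noteq> 0 \<longrightarrow> h2 z \<noteq> 0 \<longrightarrow> F (g1 z / h1 z) (g2 z / h2 z) = k z / (h1 z * h2 z)"
    using num[OF h] by blast
  have "interior {z\<in>U. h1 z * h2 z = 0} = {}"
  proof (rule ccontr)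
    assume "interior {z\<in>U. h1 z * h2 z = 0} \<noteq> {}"
    then obtain y where y: "y \<in> interior {z\<in>U. h1 z * h2 z = 0}" by blast
    then have "y \<in> closure D" using D(2) interior_subset by blast
    then have "D \<inter> interior {z\<in>U. h1 z * h2 z = 0} \<noteq> {}"
      using y unfolding closure_iff_nhds_not_empty by blast
    then show False using interior_subset[of "{z\<in>U. h1 z * h2 z = 0}"] by (auto simp: D_def)
  qed
  moreover have "agree_near x (\<lambda>z. F (f1 z) (f2 z)) (\<lambda>z. F (g1 z / h1 z) (g2 z / h2 z))"
    by (rule agree_near_combine[OF 1(6) 2(6)]) auto
  moreover have "agree_near x (\<lambda>z. F (g1 z / h1 z) (g2 z / h2 z)) (\<lambda>z. k z / (h1 z * h2 z))"
    by (rule agree_nearI[OF U D]) (use k in \<open>auto simp: D_def U_def\<close>)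
  ultimately show ?thesis
    unfolding mero_at_def using U k(1) holo_on_mult[OF h(2,4)]
    by (intro exI[of _ U] exI[of _ k] exI[of _ "\<lambda>z. h1 z * h2 z"])
       (auto intro: agree_near_trans)
qed

lemma mero_at_add: "mero_at x f \<Longrightarrow> mero_at x g \<Longrightarrow> mero_at x (\<lambda>z. f z + g z)"
  apply (erule (1) mero_at_binop)
  subgoal for g1 h1 g2 h2 U
    by (intro exI[of _ "\<lambda>z. g1 z * h2 z + g2 z * h1 z"])
       (auto intro!: holo_on_add holo_on_mult simp: field_simps)
  done

lemma mero_at_mult: "mero_at x f \<Longrightarrow> mero_at x g \<Longrightarrow> mero_at x (\<lambda>z. f z * g z)"
  apply (erule (1) mero_at_binop)
  subgoal for g1 h1 g2 h2 U
    by (intro exI[of _ "\<lambda>z. g1 z * g2 z"]) (auto intro!: holo_on_mult)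
  done

lemma mero_at_uminus: "mero_at x f \<Longrightarrow> mero_at x (\<lambda>z. - f z)"
  using mero_at_mult[OF mero_at_const[of x "-1"]] by simp

lemma mero_at_diff: "mero_at x f \<Longrightarrow> mero_at x g \<Longrightarrow> mero_at x (\<lambda>z. f z - g z)"
  using mero_at_add[OF _ mero_at_uminus] by fastforce

lemma mero_at_compose:
  assumes "mero_at (T x) f" and TS: "\<And>z. T (S z) = z" "\<And>z. S (T z) = z"
    and T: "\<And>z. (T has_derivative L) (at z)" "\<And>x y. L (x + y) = L x + L y"
      "\<And>c x. L (c *s x) = c *s L x"
    and S: "continuous_on UNIV S"
  shows "mero_at x (\<lambda>z. f (T z))"
proof -
  obtain U g h where *: "open U" "T x \<in> U" "holo_on g U" "holo_on h U"
     "interior {z\<in>U. h z = 0} = {}" "agree_near (T x) f (\<lambda>z. g z / h z)"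
    using assms(1) unfolding mero_at_def by blast
  have cT: "continuous_on UNIV T"
    by (intro continuous_at_imp_continuous_on ballI has_derivative_continuous[OF T(1)])
  have "interior {z \<in> T -` U. h (T z) = 0} = {}"
  proof -
    let ?E = "interior {z \<in> T -` U. h (T z) = 0}"
    have "S -` ?E \<subseteq> {z\<in>U. h z = 0}"
      using interior_subset[of "{z \<in> T -` U. h (T z) = 0}"] TS by force
    moreover have "open (S -` ?E)" using S by (simp add: continuous_on_open_vimage)
    ultimately have "S -` ?E = {}" using *(5) interior_maximal by blast
    show ?thesis
    proof (rule equals0I)
      fix y assume "y \<in> ?E"
      then have "T y \<in> S -` ?E" by (simp add: TS(2))
      with \<open>S -` ?E = {}\<close> show False by blast
    qed
  qed
  moreover have "open (T -` U)" using cT * by (simp add: continuous_on_open_vimage)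
  moreover have "agree_near x (\<lambda>z. f (T z)) (\<lambda>z. g (T z) / h (T z))"
    using agree_near_compose[OF *(6) cT S TS] .
  ultimately show ?thesis
    unfolding mero_at_def
    using * holo_on_compose_affine[OF *(3) T] holo_on_compose_affine[OF *(4) T]
    by (intro exI[of _ "T -` U"] exI[of _ "\<lambda>z. g (T z)"] exI[of _ "\<lambda>z. h (T z)"]) auto
qed

definition mero_eq :: "(complex ^ 'i::finite \<Rightarrow> complex) \<Rightarrow> (complex ^ 'i \<Rightarrow> complex) \<Rightarrow> bool" where
  "mero_eq f g \<longleftrightarrow> (\<forall>x. mero_at x f) \<and> (\<forall>x. mero_at x g) \<and> (\<forall>x. agree_near x f g)"

lemma part_equivp_mero_eq: "part_equivp mero_eq"
  by (rule part_equivpI)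
     (auto simp: mero_eq_def symp_def transp_def intro: agree_near_sym agree_near_trans
       intro!: exI[of _ "\<lambda>_. 0"] mero_at_const)

quotient_type 'i mero = "complex ^ 'i::finite \<Rightarrow> complex" / partial: mero_eq
  morphisms rep_mero Mero
  by (rule part_equivp_mero_eq)

instantiation mero :: (finite) comm_ring_1
begin

lift_definition zero_mero :: "'a mero" is "\<lambda>_. 0"
  by (simp add: mero_eq_def mero_at_const)

lift_definition one_mero :: "'a mero" is "\<lambda>_. 1"
  by (simp add: mero_eq_def mero_at_const)

lift_definition plus_mero :: "'a mero \<Rightarrow> 'a mero \<Rightarrow> 'a mero" is "\<lambda>f g z. f z + g z"
  by (auto simp: mero_eq_def mero_at_add intro: agree_near_combine)

lift_definition minus_mero :: "'a mero \<Rightarrow> 'a mero \<Rightarrow> 'a mero" is "\<lambda>f g z. f z - g z"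
  by (auto simp: mero_eq_def mero_at_diff intro: agree_near_combine)

lift_definition times_mero :: "'a mero \<Rightarrow> 'a mero \<Rightarrow> 'a mero" is "\<lambda>f g z. f z * g z"
  by (auto simp: mero_eq_def mero_at_mult intro: agree_near_combine)

lift_definition uminus_mero :: "'a mero \<Rightarrow> 'a mero" is "\<lambda>f z. - f z"
  by (auto simp: mero_eq_def mero_at_uminus intro: agree_near_combine[OF _ agree_near_refl])

lemma not_agree_near_0_1: "\<not> agree_near x (\<lambda>_. 0 :: 'b::zero_neq_one) (\<lambda>_. 1)"
  by (simp add: agree_near_def)

instance
proof
  show "(0 :: 'a mero) \<noteq> 1"
    by transfer (simp add: mero_eq_def not_agree_near_0_1)
qed (transfer; force simp: mero_eq_def algebra_simps mero_at_const intro!: mero_at_add mero_at_mult mero_at_diff mero_at_uminus)+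

end

lift_definition const_mero :: "complex \<Rightarrow> 'i::finite mero" is "\<lambda>c _. c"
  by (simp add: mero_eq_def mero_at_const)

lemma mero_at_translate: "mero_at (x - \<xi>) f \<Longrightarrow> mero_at x (\<lambda>z. f (z - \<xi>))"
  by (rule mero_at_compose[where S = "\<lambda>z. z + \<xi>" and L = "\<lambda>h. h"])
     (auto intro!: derivative_eq_intros continuous_intros)

lemma agree_near_translate:
  fixes \<xi> :: "'a::real_normed_vector"
  shows "agree_near (x - \<xi>) f g \<Longrightarrow> agree_near x (\<lambda>z. f (z - \<xi>)) (\<lambda>z. g (z - \<xi>))"
  by (rule agree_near_compose[where S = "\<lambda>z. z + \<xi>"]) (auto intro!: continuous_intros)

lift_definition translate :: "complex ^ 'i::finite \<Rightarrow> 'i mero \<Rightarrow> 'i mero" is "\<lambda>\<xi> f z. f (z - \<xi>)"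
  by (auto simp: mero_eq_def intro: mero_at_translate agree_near_translate)


section \<open>The group \<open>G\<close> and its action on functions\<close>

definition labelling :: "nat \<Rightarrow> (nat \<Rightarrow> nat) \<Rightarrow> ('i::finite \<Rightarrow> nat \<times> nat) \<Rightarrow> bool" where
  "labelling n N lab \<longleftrightarrow> bij_betw lab UNIV (SIGMA k:{1..n}. {1..N k})"

text \<open>The product of symmetric groups, as the permutations of the index pairs fixing all \<open>k\<close>.\<close>

definition Gp :: "('i::finite \<Rightarrow> nat \<times> nat) \<Rightarrow> 'i perm set" where
  "Gp lab = {g. \<forall>i. fst (lab (Perm.apply g i)) = fst (lab i)}"

definition vact :: "'i::finite perm \<Rightarrow> complex ^ 'i \<Rightarrow> complex ^ 'i" where
  "vact g v = (\<chi> i. v $ Perm.apply (inverse g) i)"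

lemma vact_inverse [simp]: "vact g (vact (inverse g) v) = v" "vact (inverse g) (vact g v) = v"
  by (simp_all add: vact_def vec_eq_iff apply_inverse bij_is_surj bij_is_inj surj_f_inv_f
      inv_inv_eq)

lemma vact_add: "vact g (v + w) = vact g v + vact g w"
  by (simp add: vact_def vec_eq_iff)

lemma vact_scale: "vact g (c *s v) = c *s vact g v"
  by (simp add: vact_def vec_eq_iff)

lemma bounded_linear_vact: "bounded_linear (vact g)"
  by (auto simp: vact_add vact_def vec_eq_iff intro!: linearI
      simp flip: linear_conv_bounded_linear)

lemma continuous_vact: "continuous_on UNIV (vact g)"
  using bounded_linear_vact linear_continuous_on by blast

lemma mero_at_vact: "mero_at (vact g x) f \<Longrightarrow> mero_at x (\<lambda>z. f (vact g z))"
  by (rule mero_at_compose[where S = "vact (inverse g)" and L = "vact g"])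
     (auto intro: bounded_linear_imp_has_derivative bounded_linear_vact continuous_vact
       simp: vact_add vact_scale)

lemma agree_near_vact:
  "agree_near (vact g x) f h \<Longrightarrow> agree_near x (\<lambda>z. f (vact g z)) (\<lambda>z. h (vact g z))"
  by (rule agree_near_compose[where S = "vact (inverse g)"]) (auto intro: continuous_vact)

lift_definition mact :: "'i::finite perm \<Rightarrow> 'i mero \<Rightarrow> 'i mero" is
  "\<lambda>g f z. f (vact (inverse g) z)"
  by (auto simp: mero_eq_def intro: mero_at_vact agree_near_vact)

definition delta1 :: "('i::finite \<Rightarrow> nat \<times> nat) \<Rightarrow> nat \<Rightarrow> complex ^ 'i" where
  "delta1 lab k = (\<chi> i. if lab i = (k, 1) then 1 else 0)"

definition xi :: "('i::finite \<Rightarrow> nat \<times> nat) \<Rightarrow> nat \<Rightarrow> complex \<Rightarrow> complex ^ 'i" where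
  "xi lab k a = a *s delta1 lab k"

fun regular_functions :: "setting \<Rightarrow> 'i::finite mero set" where
  "regular_functions Analytic = {Mero h | h. holo_on h UNIV}"
| "regular_functions Algebraic = {Mero p | p. p \<in> poly_funs}"

fun mero_functions :: "setting \<Rightarrow> 'i::finite mero set" where
  "mero_functions Analytic = UNIV"
| "mero_functions Algebraic =
     {Mero (\<lambda>z. p z / q z) | p q. p \<in> poly_funs \<and> q \<in> poly_funs \<and> q \<noteq> (\<lambda>_. 0)}"


section \<open>The skew-group ring\<close>

text \<open>
  \<open>Poly_Mapping.single \<xi> f\<close> stands for \<open>f \<phi>\<^sub>\<xi>\<close>.  The product is \<open>skew_mult\<close>; the
  library's multiplication on this type is the untwisted convolution and is not used.
\<close>

type_synonym 'i skew = "(complex ^ 'i) \<Rightarrow>\<^sub>0 'i mero"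

definition skew_mult :: "'i::finite skew \<Rightarrow> 'i skew \<Rightarrow> 'i skew" where
  "skew_mult X Y = (\<Sum>\<xi>\<in>Poly_Mapping.keys X. \<Sum>\<eta>\<in>Poly_Mapping.keys Y.
     Poly_Mapping.single (\<xi> + \<eta>)
       (Poly_Mapping.lookup X \<xi> * translate \<xi> (Poly_Mapping.lookup Y \<eta>)))"

definition skew_one :: "'i::finite skew" where
  "skew_one = Poly_Mapping.single 0 1"

definition skew_scale :: "complex \<Rightarrow> 'i::finite skew \<Rightarrow> 'i skew" where
  "skew_scale c X = Poly_Mapping.map (\<lambda>f. const_mero c * f) X"

definition skew_act :: "'i::finite perm \<Rightarrow> 'i skew \<Rightarrow> 'i skew" where
  "skew_act g X = (\<Sum>\<xi>\<in>Poly_Mapping.keys X.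
     Poly_Mapping.single (vact g \<xi>) (mact g (Poly_Mapping.lookup X \<xi>)))"

definition skew_invariants :: "setting \<Rightarrow> ('i::finite \<Rightarrow> nat \<times> nat) \<Rightarrow> 'i skew set" where
  "skew_invariants s lab = {X. (\<forall>\<xi>. Poly_Mapping.lookup X \<xi> \<in> mero_functions s) \<and>
     (\<forall>g\<in>Gp lab. skew_act g X = X)}"

definition skew_subalgebra :: "'i::finite skew set \<Rightarrow> bool" where
  "skew_subalgebra A \<longleftrightarrow> skew_one \<in> A \<and> (\<forall>X\<in>A. \<forall>Y\<in>A. X + Y \<in> A) \<and>
     (\<forall>c. \<forall>X\<in>A. skew_scale c X \<in> A) \<and> (\<forall>X\<in>A. \<forall>Y\<in>A. skew_mult X Y \<in> A)"

definition invariant_functions :: "setting \<Rightarrow> ('i::finite \<Rightarrow> nat \<times> nat) \<Rightarrow> 'i skew set" where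
  "invariant_functions s lab =
     {Poly_Mapping.single 0 f | f. f \<in> regular_functions s \<and> (\<forall>g\<in>Gp lab. mact g f = f)}"

definition standard_element :: "setting \<Rightarrow> nat \<Rightarrow> ('i::finite \<Rightarrow> nat \<times> nat) \<Rightarrow> 'i skew \<Rightarrow> bool" where
  "standard_element s n lab X \<longleftrightarrow> (\<exists>a. \<exists>k\<in>{1..n}. \<exists>f\<in>mero_functions s.
     X = (\<Sum>g\<in>Gp lab. skew_act g (Poly_Mapping.single (xi lab k a) f)))"

definition standard_combinations ::
    "setting \<Rightarrow> nat \<Rightarrow> ('i::finite \<Rightarrow> nat \<times> nat) \<Rightarrow> 'i skew set" where
  "standard_combinations s n lab =
     {\<Sum>X\<in>T. skew_scale (c X) X | T c. finite T \<and> (\<forall>X\<in>T. standard_element s n lab X)}"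

definition standard_type_A :: "setting \<Rightarrow> nat \<Rightarrow> ('i::finite \<Rightarrow> nat \<times> nat) \<Rightarrow> 'i skew set \<Rightarrow> bool" where
  "standard_type_A s n lab A \<longleftrightarrow> A \<subseteq> skew_invariants s lab \<and>
     (\<exists>L. L \<subseteq> standard_combinations s n lab \<and> A = skew_subalgebra hull L)"

definition fin_gen_over_invariants ::
    "setting \<Rightarrow> ('i::finite \<Rightarrow> nat \<times> nat) \<Rightarrow> 'i skew set \<Rightarrow> bool" where
  "fin_gen_over_invariants s lab A \<longleftrightarrow> invariant_functions s lab \<subseteq> A \<and>
     (\<exists>T. finite T \<and> A = skew_subalgebra hull (invariant_functions s lab \<union> T))"


section \<open>Direct sum of germs and the action of the skew-group ring on it\<close>

text \<open>
  An element of the direct sum of all \<open>\<M>\<^sub>x\<close> is represented by a family \<open>F\<close>, where the function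
  \<open>F x\<close> represents a germ at \<open>x\<close>, only finitely many of these germs being nonzero.
\<close>

definition germ_family :: "(complex ^ 'i::finite \<Rightarrow> complex ^ 'i \<Rightarrow> complex) \<Rightarrow> bool" where
  "germ_family F \<longleftrightarrow> (\<forall>x. mero_at x (F x)) \<and> finite {x. \<not> agree_near x (F x) (\<lambda>_. 0)}"

definition germ_eq :: "(complex ^ 'i::finite \<Rightarrow> complex ^ 'i \<Rightarrow> complex) \<Rightarrow>
    (complex ^ 'i \<Rightarrow> complex ^ 'i \<Rightarrow> complex) \<Rightarrow> bool" where
  "germ_eq F F' \<longleftrightarrow> germ_family F \<and> germ_family F' \<and> (\<forall>x. agree_near x (F x) (F' x))"

lemma germ_family_zero: "germ_family (\<lambda>_ _. 0)"
  by (simp add: germ_family_def mero_at_const)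

lemma part_equivp_germ_eq: "part_equivp germ_eq"
  by (rule part_equivpI)
     (auto simp: germ_eq_def symp_def transp_def germ_family_zero
       intro: agree_near_sym agree_near_trans intro!: exI[of _ "\<lambda>_ _. 0"])

quotient_type 'i germs = "complex ^ 'i::finite \<Rightarrow> complex ^ 'i \<Rightarrow> complex" / partial: germ_eq
  by (rule part_equivp_germ_eq)

lemma germ_family_add:
  assumes "germ_family F" "germ_family F'"
  shows "germ_family (\<lambda>x z. F x z + F' x z)"
proof -
  have "{x. \<not> agree_near x (\<lambda>z. F x z + F' x z) (\<lambda>_. 0)} \<subseteq>
      {x. \<not> agree_near x (F x) (\<lambda>_. 0)} \<union> {x. \<not> agree_near x (F' x) (\<lambda>_. 0)}"
    using agree_near_combine[of _ "F _" "\<lambda>_. 0" "F' _" "\<lambda>_. 0" "\<lambda>z. F _ z + F' _ z" "\<lambda>_. 0"]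
    by auto
  from finite_subset[OF this] show ?thesis
    using assms by (simp add: germ_family_def mero_at_add)
qed

lemma germ_family_uminus:
  assumes "germ_family F"
  shows "germ_family (\<lambda>x z. - F x z)"
proof -
  have "{x. \<not> agree_near x (\<lambda>z. - F x z) (\<lambda>_. 0)} \<subseteq> {x. \<not> agree_near x (F x) (\<lambda>_. 0)}"
  proof -
    have "agree_near x (\<lambda>z. - F x z) (\<lambda>_. 0)" if "agree_near x (F x) (\<lambda>_. 0)" for x
      by (rule agree_near_combine[OF that agree_near_refl]) simp
    then show ?thesis by auto
  qed
  from finite_subset[OF this] show ?thesis
    using assms by (simp add: germ_family_def mero_at_uminus)
qed

lemma germ_family_diff:
  "germ_family F \<Longrightarrow> germ_family F' \<Longrightarrow> germ_family (\<lambda>x z. F x z - F' x z)"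
  using germ_family_add[OF _ germ_family_uminus, of F F'] by simp

instantiation germs :: (finite) ab_group_add
begin

lift_definition zero_germs :: "'a germs" is "\<lambda>_ _. 0"
  by (simp add: germ_eq_def germ_family_zero)

lift_definition plus_germs :: "'a germs \<Rightarrow> 'a germs \<Rightarrow> 'a germs" is "\<lambda>F F' x z. F x z + F' x z"
  by (auto simp: germ_eq_def germ_family_add intro: agree_near_combine)

lift_definition minus_germs :: "'a germs \<Rightarrow> 'a germs \<Rightarrow> 'a germs" is "\<lambda>F F' x z. F x z - F' x z"
  by (auto simp: germ_eq_def germ_family_diff intro: agree_near_combine)

lift_definition uminus_germs :: "'a germs \<Rightarrow> 'a germs" is "\<lambda>F x z. - F x z"
  by (auto simp: germ_eq_def germ_family_uminus intro: agree_near_combine[OF _ agree_near_refl])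

instance
  by standard
     (transfer; force simp: germ_eq_def algebra_simps germ_family_zero
       intro!: germ_family_add germ_family_diff germ_family_uminus)+

end

lemma germ_family_term:
  assumes f: "\<And>x. mero_at x f" and F: "germ_family F"
  shows "germ_family (\<lambda>y z. f z * F (y - \<xi>) (z - \<xi>))"
proof -
  have "{y. \<not> agree_near y (\<lambda>z. f z * F (y - \<xi>) (z - \<xi>)) (\<lambda>_. 0)} \<subseteq>
      (\<lambda>x. x + \<xi>) ` {x. \<not> agree_near x (F x) (\<lambda>_. 0)}"
  proof
    fix y assume y: "y \<in> {y. \<not> agree_near y (\<lambda>z. f z * F (y - \<xi>) (z - \<xi>)) (\<lambda>_. 0)}"
    have "\<not> agree_near (y - \<xi>) (F (y - \<xi>)) (\<lambda>_. 0)"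
    proof
      assume "agree_near (y - \<xi>) (F (y - \<xi>)) (\<lambda>_. 0)"
      from agree_near_translate[OF this]
      have "agree_near y (\<lambda>z. f z * F (y - \<xi>) (z - \<xi>)) (\<lambda>_. 0)"
        by (rule agree_near_combine[OF _ agree_near_refl]) simp
      with y show False by simp
    qed
    then show "y \<in> (\<lambda>x. x + \<xi>) ` {x. \<not> agree_near x (F x) (\<lambda>_. 0)}"
      by (intro image_eqI[of _ _ "y - \<xi>"]) auto
  qed
  from finite_subset[OF this] show ?thesis
    using assms by (simp add: germ_family_def mero_at_mult mero_at_translate)
qed

text \<open>The operator \<open>f \<phi>\<^sub>\<xi>\<close>, mapping \<open>\<M>\<^sub>x\<close> to \<open>\<M>\<^bsub>x+\<xi>\<^esub>\<close>.\<close>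

lift_definition term_apply :: "'i::finite mero \<Rightarrow> complex ^ 'i \<Rightarrow> 'i germs \<Rightarrow> 'i germs" is
  "\<lambda>f \<xi> F y z. f z * F (y - \<xi>) (z - \<xi>)"
  by (auto simp: germ_eq_def mero_eq_def intro: germ_family_term
      agree_near_combine[OF _ agree_near_translate])

definition skew_apply :: "'i::finite skew \<Rightarrow> 'i germs \<Rightarrow> 'i germs" where
  "skew_apply X F = (\<Sum>\<xi>\<in>Poly_Mapping.keys X. term_apply (Poly_Mapping.lookup X \<xi>) \<xi> F)"

lemma germ_family_vact:
  assumes "germ_family F"
  shows "germ_family (\<lambda>y z. F (vact g y) (vact g z))"
proof -
  have "{y. \<not> agree_near y (\<lambda>z. F (vact g y) (vact g z)) (\<lambda>_. 0)} \<subseteq>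
      vact (inverse g) ` {x. \<not> agree_near x (F x) (\<lambda>_. 0)}"
  proof
    fix y assume "y \<in> {y. \<not> agree_near y (\<lambda>z. F (vact g y) (vact g z)) (\<lambda>_. 0)}"
    then have "\<not> agree_near (vact g y) (F (vact g y)) (\<lambda>_. 0)"
      using agree_near_vact[of g y "F (vact g y)" "\<lambda>_. 0"] by auto
    then show "y \<in> vact (inverse g) ` {x. \<not> agree_near x (F x) (\<lambda>_. 0)}"
      by (intro image_eqI[of _ _ "vact g y"]) auto
  qed
  from finite_subset[OF this] show ?thesis
    using assms by (simp add: germ_family_def mero_at_vact)
qed

lift_definition germ_act :: "'i::finite perm \<Rightarrow> 'i germs \<Rightarrow> 'i germs" is
  "\<lambda>g F y z. F (vact (inverse g) y) (vact (inverse g) z)"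
  by (auto simp: germ_eq_def intro: germ_family_vact agree_near_vact)

fun regular_at :: "setting \<Rightarrow> complex ^ 'i::finite \<Rightarrow> (complex ^ 'i \<Rightarrow> complex) \<Rightarrow> bool" where
  "regular_at Analytic x f \<longleftrightarrow> (\<exists>U. open U \<and> x \<in> U \<and> holo_on f U)"
| "regular_at Algebraic x f \<longleftrightarrow>
     (\<exists>p q. p \<in> poly_funs \<and> q \<in> poly_funs \<and> q x \<noteq> 0 \<and> f = (\<lambda>z. p z / q z))"

lift_definition germ_regular :: "setting \<Rightarrow> complex ^ 'i::finite \<Rightarrow> 'i germs \<Rightarrow> bool" is
  "\<lambda>s x F. \<exists>f. regular_at s x f \<and> agree_near x (F x) f"
  by (auto simp: germ_eq_def; meson agree_near_sym agree_near_trans)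

lift_definition germ_support :: "'i::finite germs \<Rightarrow> (complex ^ 'i) set" is
  "\<lambda>F. {x. \<not> agree_near x (F x) (\<lambda>_. 0)}"
  by (auto simp: germ_eq_def; meson agree_near_sym agree_near_trans)

definition orbits :: "('i::finite \<Rightarrow> nat \<times> nat) \<Rightarrow> (complex ^ 'i) set set" where
  "orbits lab = {(\<lambda>g. vact g x) ` Gp lab | x. True}"

definition O_inv :: "setting \<Rightarrow> ('i::finite \<Rightarrow> nat \<times> nat) \<Rightarrow> (complex ^ 'i) set \<Rightarrow> 'i germs set" where
  "O_inv s lab \<omega> = {F. germ_support F \<subseteq> \<omega> \<and> (\<forall>x\<in>\<omega>. germ_regular s x F) \<and>
     (\<forall>g\<in>Gp lab. germ_act g F = F)}"

definition O_total :: "setting \<Rightarrow> ('i::finite \<Rightarrow> nat \<times> nat) \<Rightarrow> 'i germs set" where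
  "O_total s lab = {\<Sum>\<omega>\<in>W. u \<omega> | W u. finite W \<and> W \<subseteq> orbits lab \<and> (\<forall>\<omega>\<in>W. u \<omega> \<in> O_inv s lab \<omega>)}"

definition preserves_O :: "setting \<Rightarrow> ('i::finite \<Rightarrow> nat \<times> nat) \<Rightarrow> 'i skew set \<Rightarrow> bool" where
  "preserves_O s lab A \<longleftrightarrow> (\<forall>X\<in>A. skew_apply X ` O_total s lab \<subseteq> O_total s lab)"


section \<open>Rational Galois orders\<close>

definition is_character :: "('i::finite \<Rightarrow> nat \<times> nat) \<Rightarrow> ('i perm \<Rightarrow> complex) \<Rightarrow> bool" where
  "is_character lab ch \<longleftrightarrow> (\<forall>g\<in>Gp lab. ch g \<noteq> 0) \<and>
     (\<forall>g\<in>Gp lab. \<forall>h\<in>Gp lab. ch (g * h) = ch g * ch h)"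

definition is_hyperplane :: "(complex ^ 'i::finite) set \<Rightarrow> bool" where
  "is_hyperplane H \<longleftrightarrow> (\<exists>\<gamma>. complex_functional \<gamma> \<and> \<gamma> \<noteq> (\<lambda>_. 0) \<and> H = {v. \<gamma> v = 0})"

definition fixed_space :: "'i::finite perm \<Rightarrow> (complex ^ 'i) set" where
  "fixed_space g = {v. vact g v = v}"

definition reflection_hyperplanes :: "('i::finite \<Rightarrow> nat \<times> nat) \<Rightarrow> (complex ^ 'i) set set" where
  "reflection_hyperplanes lab = {fixed_space g | g. g \<in> Gp lab \<and> is_hyperplane (fixed_space g)}"

text \<open>
  The reflections in \<open>G\<close> are transpositions, so \<open>\<sigma>\<^sub>H\<close> below is unique; \<open>\<gamma>\<^sub>H\<close> is unique up to a nonzero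
  scalar, which does not affect holomorphy of \<open>d\<^sub>\<chi> X\<close>.  The matrix of \<open>\<sigma>\<^sub>H\<^sup>*\<close> on \<open>V\<^sup>*\<close> is the transpose.
\<close>

definition sigma_H :: "('i::finite \<Rightarrow> nat \<times> nat) \<Rightarrow> (complex ^ 'i) set \<Rightarrow> 'i perm" where
  "sigma_H lab H = (SOME g. g \<in> Gp lab \<and> fixed_space g = H)"

definition gamma_H :: "(complex ^ 'i::finite) set \<Rightarrow> complex ^ 'i \<Rightarrow> complex" where
  "gamma_H H = (SOME \<gamma>. complex_functional \<gamma> \<and> {v. \<gamma> v = 0} = H)"

definition a_H :: "('i::finite \<Rightarrow> nat \<times> nat) \<Rightarrow> ('i perm \<Rightarrow> complex) \<Rightarrow> (complex ^ 'i) set \<Rightarrow> nat" where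
  "a_H lab ch H = (LEAST a. ch (sigma_H lab H) = det (transpose (matrix (vact (sigma_H lab H)))) ^ a)"

definition d_char :: "('i::finite \<Rightarrow> nat \<times> nat) \<Rightarrow> ('i perm \<Rightarrow> complex) \<Rightarrow> complex ^ 'i \<Rightarrow> complex" where
  "d_char lab ch x = (\<Prod>H\<in>reflection_hyperplanes lab. gamma_H H x ^ a_H lab ch H)"

definition rational_galois_order ::
    "setting \<Rightarrow> ('i::finite \<Rightarrow> nat \<times> nat) \<Rightarrow> 'i skew set \<Rightarrow> bool" where
  "rational_galois_order s lab A \<longleftrightarrow> A \<subseteq> skew_invariants s lab \<and> invariant_functions s lab \<subseteq> A \<and>
     (\<exists>T. finite T \<and> T \<subseteq> skew_invariants s lab \<and>
        A = skew_subalgebra hull (invariant_functions s lab \<union> T) \<and>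
        (\<forall>X\<in>T. \<exists>ch. is_character lab ch \<and>
           (\<forall>\<xi>. Mero (d_char lab ch) * Poly_Mapping.lookup X \<xi> \<in> regular_functions s)))"

end

theory Submission
  imports Defs "HOL-Computational_Algebra.Fundamental_Theorem_Algebra"
begin

text \<open>
  Let \<open>X = \<Sum>\<^sub>\<xi> f\<^sub>\<xi> \<phi>\<^sub>\<xi>\<close> be a linear combination of standard elements that preserves the direct sum of
  the spaces of invariant germs. All its shifts are multiples \<open>a \<delta>\<^sub>i\<close> of basis vectors, \<open>i\<close> running
  through the coordinates of \<open>V\<close>. It is shown that the product of all \<open>z\<^sub>i - z\<^sub>l\<close>, \<open>l \<noteq> i\<close> in the
  block of \<open>i\<close>, clears the denominator of the coefficient of \<open>a \<delta>\<^sub>i\<close>. For the sign character these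
  differences are among the factors of \<open>d_char\<close>, each with exponent one (\<open>d_char_sign_factor\<close>), so
  this one character works for all \<open>X\<close>.

  To find the pole of the coefficient of \<open>a \<delta>\<^sub>i\<close> at a point \<open>y\<close>, place an invariant polynomial \<open>P\<close> on
  the orbit of \<open>y - a \<delta>\<^sub>i\<close>, extended by zero to the other orbits, and apply \<open>X\<close>. The germ of the result
  at \<open>y\<close> is the sum of \<open>f\<^sub>\<xi>(z) P(z - \<xi>)\<close> over the shifts \<open>\<xi>\<close> that lead from this orbit to \<open>y\<close>
  (\<open>hol_germ_of_preserving\<close>), and it is holomorphic by assumption. Since block sums of coordinates are
  invariant, all these \<open>\<xi>\<close> have the form \<open>a \<delta>\<^sub>j\<close> with the same \<open>a\<close> and with \<open>j\<close> in the block of \<open>i\<close>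
  (\<open>axis_in_orbit_of_difference\<close>). For \<open>a = 0\<close> there is a single term and \<open>P = 1\<close> shows that it has no
  pole. For \<open>a \<noteq> 0\<close> let \<open>P\<close> be the power sums of the block. They turn into
  \<open>\<Sum>\<^sub>j f\<^sub>j(z) ((z\<^sub>j - a)\<^sup>r - z\<^sub>j\<^sup>r)\<close>, and as the polynomials \<open>(w - a)\<^sup>r - w\<^sup>r\<close> span all polynomials in one
  variable, \<open>\<Sum>\<^sub>j f\<^sub>j(z) p(z\<^sub>j)\<close> is holomorphic at \<open>y\<close> for every \<open>p\<close>, even with coefficients that are
  holomorphic in \<open>z\<close>. Taking for \<open>p\<close> the product of the \<open>w - z\<^sub>l\<close>, \<open>l \<noteq> i\<close>, isolates
  \<open>f\<^sub>i(z) \<Prod>\<^sub>l (z\<^sub>i - z\<^sub>l)\<close> (\<open>hol_germ_separate\<close>).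

  It remains to pass from every point \<open>y\<close> to the whole space. Holomorphic germs glue to an entire
  function, and an entire function that is a quotient of polynomials is a polynomial
  (\<open>regular_functions_if_hol_germs\<close>); this settles the analytic and the algebraic setting
  simultaneously. Finally, an algebra that is finitely generated over the invariant functions and
  generated by combinations of standard elements is generated over the invariant functions by
  finitely many of these combinations (\<open>finite_set_of_standard_generators\<close>), and all of them are
  of the kind considered above.
\<close>


section \<open>Polynomial functions\<close>

lemma complex_functional_coord: "complex_functional (\<lambda>z :: complex ^ 'i::finite. z $ i)"
  by (simp add: complex_functional_iff)

lemma holo_on_poly_funs: "p \<in> poly_funs \<Longrightarrow> holo_on p U"
proof (induction rule: poly_funs.induct)
  case (coord i)
  have "((\<lambda>z :: complex ^ 'a. z $ i) has_derivative (\<lambda>z. z $ i)) (at z)" for z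
    by (rule bounded_linear_imp_has_derivative[OF bounded_linear_vec_nth])
  then show ?case
    unfolding holo_on_def using complex_functional_coord by blast
qed (auto intro: holo_on_const holo_on_add holo_on_mult)

lemma continuous_on_poly_funs: "p \<in> poly_funs \<Longrightarrow> continuous_on U p"
  by (rule holo_on_continuous[OF holo_on_poly_funs])

lemma poly_funs_minus: "p \<in> poly_funs \<Longrightarrow> q \<in> poly_funs \<Longrightarrow> (\<lambda>z. p z - q z) \<in> poly_funs"
  using poly_funs.add[OF _ poly_funs.mult[OF poly_funs.const[of "-1"]], of p q] by simp

lemma poly_funs_sum:
  "(\<And>a. a \<in> A \<Longrightarrow> p a \<in> poly_funs) \<Longrightarrow> (\<lambda>z. \<Sum>a\<in>A. p a z) \<in> poly_funs"
  by (induction A rule: infinite_finite_induct) (auto intro: poly_funs.intros)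

lemma poly_funs_prod:
  "(\<And>a. a \<in> A \<Longrightarrow> p a \<in> poly_funs) \<Longrightarrow> (\<lambda>z. \<Prod>a\<in>A. p a z) \<in> poly_funs"
  by (induction A rule: infinite_finite_induct) (auto intro: poly_funs.intros)

lemma poly_funs_power: "p \<in> poly_funs \<Longrightarrow> (\<lambda>z. p z ^ m) \<in> poly_funs"
  by (induction m) (auto intro: poly_funs.intros)

lemma poly_funs_functional:
  fixes \<gamma> :: "complex ^ 'i::finite \<Rightarrow> complex"
  assumes "complex_functional \<gamma>" shows "\<gamma> \<in> poly_funs"
proof -
  have *: "\<gamma> (x + y) = \<gamma> x + \<gamma> y" "\<gamma> (c *s x) = c * \<gamma> x" for x y c
    using assms by (auto simp: complex_functional_iff)
  have 0: "\<gamma> 0 = 0" using *(1)[of 0 0] by simp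
  have sum: "\<gamma> (\<Sum>i\<in>I. w i) = (\<Sum>i\<in>I. \<gamma> (w i))" if "finite I" for I and w :: "'i \<Rightarrow> complex ^ 'i"
    using that by induction (auto simp: * 0)
  have "\<gamma> z = (\<Sum>i\<in>UNIV. z $ i * \<gamma> (axis i 1))" for z
    using sum[of UNIV "\<lambda>i. z $ i *s axis i 1"] by (simp add: basis_expansion *)
  then have "\<gamma> = (\<lambda>z. \<Sum>i\<in>UNIV. z $ i * \<gamma> (axis i 1))" by blast
  also have "\<dots> \<in> poly_funs" by (intro poly_funs_sum poly_funs.intros)
  finally show ?thesis .
qed

text \<open>
  The degree bound holds for all lines at once. Interpolation along coordinate lines can therefore
  use one fixed set of nodes.
\<close>

lemma poly_funs_on_lines:
  assumes "p \<in> poly_funs"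
  shows "\<exists>D. \<forall>u v. \<exists>P. degree P \<le> D \<and> (\<forall>t. p (u + t *s v) = poly P t)"
  using assms
proof induction
  case (const c)
  show ?case by (intro exI[of _ 0] allI exI[of _ "[:c:]" for c]) auto
next
  case (coord i)
  have "degree [:u $ i, v $ i:] \<le> 1 \<and> (\<forall>t. (u + t *s v) $ i = poly [:u $ i, v $ i:] t)"
    for u v :: "complex ^ 'a"
    by auto
  then show ?case by blast
next
  case (add p q)
  then obtain D1 D2 where D: "\<And>u v. \<exists>P. degree P \<le> D1 \<and> (\<forall>t. p (u + t *s v) = poly P t)"
    "\<And>u v. \<exists>P. degree P \<le> D2 \<and> (\<forall>t. q (u + t *s v) = poly P t)" by metis
  show ?case
  proof (intro exI[of _ "max D1 D2"] allI)
    fix u v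
    from D obtain P Q where "degree P \<le> D1" "\<forall>t. p (u + t *s v) = poly P t"
      "degree Q \<le> D2" "\<forall>t. q (u + t *s v) = poly Q t" by metis
    then show "\<exists>R. degree R \<le> max D1 D2 \<and> (\<forall>t. p (u + t *s v) + q (u + t *s v) = poly R t)"
      by (intro exI[of _ "P + Q"]) (auto intro!: degree_add_le)
  qed
next
  case (mult p q)
  then obtain D1 D2 where D: "\<And>u v. \<exists>P. degree P \<le> D1 \<and> (\<forall>t. p (u + t *s v) = poly P t)"
    "\<And>u v. \<exists>P. degree P \<le> D2 \<and> (\<forall>t. q (u + t *s v) = poly P t)" by metis
  show ?case
  proof (intro exI[of _ "D1 + D2"] allI)
    fix u v
    from D obtain P Q where "degree P \<le> D1" "\<forall>t. p (u + t *s v) = poly P t"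
      "degree Q \<le> D2" "\<forall>t. q (u + t *s v) = poly Q t" by metis
    then show "\<exists>R. degree R \<le> D1 + D2 \<and> (\<forall>t. p (u + t *s v) * q (u + t *s v) = poly R t)"
      by (intro exI[of _ "P * Q"]) (auto intro: order.trans[OF degree_mult_le])
  qed
qed

lemma continuous_on_complex_line:
  "continuous_on U (\<lambda>t::complex. u + t *s (v :: complex ^ 'i::finite))"
  unfolding vector_scalar_mult_def
  by (intro continuous_on_add continuous_on_const continuous_on_vec_lambda continuous_intros)

text \<open>
  A line from a point around which \<open>q\<close> vanishes to a point where \<open>q\<close> does not vanish would carry a
  nonzero polynomial in one variable with infinitely many roots.
\<close>

lemma poly_funs_zeros_interior_empty:
  fixes q :: "complex ^ 'i::finite \<Rightarrow> complex"
  assumes q: "q \<in> poly_funs" "q \<noteq> (\<lambda>_. 0)"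
  shows "interior {z. q z = 0} = {}"
proof (rule equals0I)
  fix x assume "x \<in> interior {z. q z = 0}"
  then obtain W where W: "open W" "x \<in> W" "W \<subseteq> {z. q z = 0}" unfolding interior_def by blast
  obtain w where w: "q w \<noteq> 0" using q(2) by auto
  obtain P where P: "\<And>t. q (x + t *s (w - x)) = poly P t"
    using poly_funs_on_lines[OF q(1)] by metis
  have "open ((\<lambda>t. x + t *s (w - x)) -` W)" 
    by (rule open_vimage[OF W(1) continuous_on_complex_line])
  moreover have "0 \<in> (\<lambda>t. x + t *s (w - x)) -` W" using W(2) by simp
  ultimately have "infinite ((\<lambda>t. x + t *s (w - x)) -` W)"
    using finite_imp_not_open by blast
  moreover have "(\<lambda>t. x + t *s (w - x)) -` W \<subseteq> {t. poly P t = 0}"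
    using W(3) P by auto
  ultimately have "P = 0" using poly_roots_finite finite_subset by blast
  with P[of 1] w show False by simp
qed


section \<open>Continuous quotients of polynomials\<close>

text \<open>
  A root of \<open>Q\<close> is a root of \<open>P = Q h\<close>, so the linear factor can be cancelled from both; away from
  the root the cancelled identity is clear, and continuity of \<open>h\<close> extends it to the root. Induction
  on the degree of \<open>Q\<close> removes all the roots.
\<close>

lemma continuous_quotient_poly:
  fixes P Q :: "complex poly"
  assumes "Q \<noteq> 0" "continuous_on UNIV h" "\<And>t. poly Q t * h t = poly P t"
  shows "\<exists>R. degree R \<le> degree P \<and> (\<forall>t. h t = poly R t)"
  using assms
proof (induction "degree Q" arbitrary: P Q)
  case 0
  then obtain c where c: "Q = [:c:]" "c \<noteq> 0" by (metis degree_0_id degree_eq_zeroE pCons_0_0)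
  show ?case
    using 0(4) c by (intro exI[of _ "smult (inverse c) P"]) (auto simp flip: 0(4))
next
  case (Suc m)
  then have "\<not> constant (poly Q)" by (simp add: constant_degree)
  then obtain r where r: "poly Q r = 0" using fundamental_theorem_of_algebra by blast
  then have "poly P r = 0" using Suc.prems(3)[of r] by simp
  with r obtain P' Q' where PQ: "Q = [:-r, 1:] * Q'" "P = [:-r, 1:] * P'"
    unfolding poly_eq_0_iff_dvd dvd_def by blast
  have Q': "Q' \<noteq> 0" using Suc.prems(1) PQ by auto
  then have "degree Q = Suc (degree Q')"
    unfolding PQ(1) by (subst degree_mult_eq) auto
  then have deg: "m = degree Q'" using Suc.hyps by simp
  \<comment> \<open>The error of the cancelled identity; it vanishes off \<open>r\<close> and is continuous.\<close>
  define e where "e t = poly Q' t * h t - poly P' t" for t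
  have off: "e t = 0" if "t \<noteq> r" for t
  proof -
    have "(t - r) * e t = 0"
      using Suc.prems(3)[of t] by (simp add: e_def PQ algebra_simps)
    with that show ?thesis by simp
  qed
  have "continuous_on UNIV e"
    unfolding e_def by (intro continuous_intros Suc.prems)
  then have "(e \<longlongrightarrow> e r) (at r)" by (simp add: continuous_on_eq_continuous_at isContD)
  moreover have "(e \<longlongrightarrow> 0) (at r)"
    by (rule Lim_transform_eventually[OF tendsto_const]) (auto simp: eventually_at_filter off)
  ultimately have "e r = 0" using LIM_unique by blast
  with off have "poly Q' t * h t = poly P' t" for t by (cases "t = r") (auto simp: e_def)
  from Suc.hyps(1)[OF deg Q' Suc.prems(2) this]
  obtain R where R: "degree R \<le> degree P'" "\<forall>t. h t = poly R t" by blast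
  have "degree P' \<le> degree P"
  proof (cases "P' = 0")
    case False
    then show ?thesis unfolding PQ(2) by (subst degree_mult_eq) auto
  qed simp
  with R show ?case by (intro exI[of _ R]) auto
qed

definition lagrange_basis :: "nat \<Rightarrow> nat \<Rightarrow> complex poly" where
  "lagrange_basis D m = smult (inverse (\<Prod>k\<in>{..D}-{m}. of_nat m - of_nat k)) (\<Prod>k\<in>{..D}-{m}. [:- of_nat k, 1:])"

lemma poly_lagrange_basis: "m \<le> D \<Longrightarrow> k \<le> D \<Longrightarrow> poly (lagrange_basis D m) (of_nat k) = (if k = m then 1 else 0)"
  by (auto simp: lagrange_basis_def poly_prod prod_zero_iff)

lemma lagrange_interpolation:
  assumes "degree R \<le> D"
  shows "poly R t = (\<Sum>m\<le>D. poly (lagrange_basis D m) t * poly R (of_nat m))"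
proof -
  define L where "L = (\<Sum>m\<le>D. smult (poly R (of_nat m)) (lagrange_basis D m))"
  have "degree (\<Prod>k\<in>{..D}-{m}. [:- of_nat k, 1 :: complex:]) \<le> D" if "m \<le> D" for m
    using degree_prod_sum_le[of "{..D}-{m}" "\<lambda>k. [:- of_nat k, 1 :: complex:]"] that by simp
  then have "degree L \<le> D"
    unfolding L_def lagrange_basis_def
    by (intro degree_sum_le) (auto intro!: order.trans[OF degree_smult_le])
  moreover have "card (of_nat ` {..D} :: complex set) = Suc D"
    by (subst card_image) (auto simp: inj_on_def)
  moreover have "poly R (of_nat k) = poly L (of_nat k)" if "k \<le> D" for k
    using that by (simp add: L_def poly_sum poly_lagrange_basis if_distrib[of "\<lambda>x. _ * x"] sum.delta cong: if_cong)
  ultimately have "R = L"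
    using assms by (intro poly_eqI_degree[of "of_nat ` {..D}"]) auto
  then have "poly R t = poly L t" by simp
  then show ?thesis by (simp add: L_def poly_sum mult.commute)
qed

lemma poly_funs_compose_coord: "(\<lambda>z. poly P (z $ i)) \<in> poly_funs"
  unfolding poly_altdef
  by (intro poly_funs_sum poly_funs.mult poly_funs.const poly_funs_power poly_funs.coord)

text \<open>
  This replaces the appeal to unique factorisation by which a rational function without poles is
  seen to be a polynomial. On a coordinate line on which \<open>q\<close> does not vanish identically, \<open>h\<close> is a
  polynomial of degree at most \<open>D\<close>, hence determined by its values at \<open>0, \<dots>, D\<close> through Lagrange
  interpolation. The interpolation identity is a closed condition that holds where \<open>q\<close> is nonzero,
  hence everywhere. Interpolating in one coordinate after the other expresses \<open>h\<close> by its values at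
  finitely many points, with polynomial coefficients.
\<close>

lemma continuous_quotient_poly_funs:
  fixes h :: "complex ^ 'i::finite \<Rightarrow> complex"
  assumes p: "p \<in> poly_funs" and q: "q \<in> poly_funs" "q \<noteq> (\<lambda>_. 0)"
    and h: "continuous_on UNIV h" "\<And>z. q z * h z = p z"
  shows "h \<in> poly_funs"
proof -
  obtain D where D: "\<And>u v. \<exists>P. degree P \<le> D \<and> (\<forall>t. p (u + t *s v) = poly P t)"
    using poly_funs_on_lines[OF p] by metis
  define ins where "ins i t z = (\<chi> j. if j = i then t else z $ j)" for i :: 'i and t and z :: "complex ^ 'i"
  have line: "ins i t z = z + (t - z $ i) *s axis i 1" for i t z
    by (auto simp: ins_def vec_eq_iff axis_def)
  have ins_self: "ins i (z $ i) z = z" for i z by (simp add: line)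
  have cont_ins: "continuous_on UNIV (ins i t)" for i t
    unfolding ins_def
  proof (rule continuous_on_vec_lambda)
    show "continuous_on UNIV (\<lambda>z. if j = i then t else z $ j)" for j
      by (cases "j = i") (auto intro!: continuous_intros)
  qed
  have interp_generic: "h z = (\<Sum>m\<le>D. poly (lagrange_basis D m) (z $ i) * h (ins i (of_nat m) z))"
    if "q z \<noteq> 0" for z i
  proof -
    obtain P where P: "degree P \<le> D" "\<And>t. p (z + t *s axis i 1) = poly P t"
      using D[of z "axis i 1"] by auto
    obtain Q where Q: "\<And>t. q (z + t *s axis i 1) = poly Q t"
      using poly_funs_on_lines[OF q(1)] by metis
    from continuous_on_compose2[OF h(1) continuous_on_complex_line]
    have "continuous_on UNIV (\<lambda>t::complex. h (z + t *s axis i 1))" by simp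
    moreover have "Q \<noteq> 0" using Q[of 0] that by auto
    ultimately obtain R0 where R0: "degree R0 \<le> degree P" "\<forall>t. h (z + t *s axis i 1) = poly R0 t"
      using continuous_quotient_poly[of Q "\<lambda>t. h (z + t *s axis i 1)" P] h(2) P(2) Q by metis
    define R where "R = pcompose R0 [:- z $ i, 1:]"
    have R: "h (ins i t z) = poly R t" for t
      using R0(2)[rule_format, of "t - z $ i"] by (simp add: line R_def poly_pcompose)
    have "degree R \<le> D" using R0(1) P(1) by (simp add: R_def degree_pcompose)
    from lagrange_interpolation[OF this, of "z $ i"] show ?thesis
      by (simp flip: R add: ins_self)
  qed
  have interp: "h z = (\<Sum>m\<le>D. poly (lagrange_basis D m) (z $ i) * h (ins i (of_nat m) z))" for z i
  proof -
    have "closed {z. h z = (\<Sum>m\<le>D. poly (lagrange_basis D m) (z $ i) * h (ins i (of_nat m) z))}"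
      by (intro closed_Collect_eq continuous_intros h(1) continuous_on_compose2[OF h(1) cont_ins]) auto
    moreover have "{z. q z \<noteq> 0} \<subseteq> {z. h z = (\<Sum>m\<le>D. poly (lagrange_basis D m) (z $ i) * h (ins i (of_nat m) z))}"
      using interp_generic by blast
    moreover have "closure {z. q z \<noteq> 0} = UNIV"
      using nonzero_open_dense(2)[OF open_UNIV continuous_on_poly_funs[OF q(1)]]
        poly_funs_zeros_interior_empty[OF q] by auto
    ultimately show ?thesis using closure_minimal by blast
  qed
  \<comment> \<open>Free the coordinates in \<open>I\<close> one at a time, the others being frozen at those of \<open>c\<close>.\<close>
  have "(\<lambda>z. h (\<chi> j. if j \<in> I then z $ j else c $ j)) \<in> poly_funs" if "finite I" for I :: "'i set" and c
    using that
  proof (induction I arbitrary: c)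
    case empty
    show ?case by (simp add: poly_funs.const)
  next
    case (insert i I)
    have "h (\<chi> j. if j \<in> insert i I then z $ j else c $ j) =
        (\<Sum>m\<le>D. poly (lagrange_basis D m) (z $ i) * h (\<chi> j. if j \<in> I then z $ j else ins i (of_nat m) c $ j))" for z
      using insert.hyps(2)
      by (subst interp[of _ i]) (auto simp: ins_def intro!: sum.cong arg_cong[of _ _ h] simp: vec_eq_iff)
    then show ?case
      using insert.IH
      by (auto intro!: poly_funs_sum poly_funs.mult poly_funs_compose_coord)
  qed
  from this[of UNIV 0] show ?thesis by simp
qed


section \<open>Functions with holomorphic germs\<close>

text \<open>
  The function \<open>F\<close> is an arbitrary representative, of which only the germ at \<open>y\<close> matters. Both
  settings are treated through this one local notion: a germ of a rational function that is regular
  at \<open>y\<close> is in particular holomorphic there, and polynomiality is recovered globally in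
  \<open>regular_functions_if_hol_germs\<close>.
\<close>

definition hol_germ :: "complex ^ 'i::finite \<Rightarrow> (complex ^ 'i \<Rightarrow> complex) \<Rightarrow> bool" where
  "hol_germ y F \<longleftrightarrow> (\<exists>U f. open U \<and> y \<in> U \<and> holo_on f U \<and> agree_near y F f)"

lemma hol_germI: "holo_on f U \<Longrightarrow> open U \<Longrightarrow> y \<in> U \<Longrightarrow> agree_near y F f \<Longrightarrow> hol_germ y F"
  unfolding hol_germ_def by blast

lemma hol_germ_cong: "hol_germ y F \<Longrightarrow> agree_near y F F' \<Longrightarrow> hol_germ y F'"
  unfolding hol_germ_def using agree_near_trans[OF agree_near_sym, of y F F'] by blast

lemma hol_germ_poly_funs: "p \<in> poly_funs \<Longrightarrow> hol_germ y p"
  by (rule hol_germI[OF holo_on_poly_funs open_UNIV]) auto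

lemma hol_germ_const: "hol_germ y (\<lambda>_. c)"
  by (intro hol_germ_poly_funs poly_funs.const)

lemma hol_germ_binop:
  fixes y :: "complex ^ 'i::finite"
  assumes "hol_germ y F" "hol_germ y G"
    and "\<And>f g (U :: (complex ^ 'i) set). holo_on f U \<Longrightarrow> holo_on g U \<Longrightarrow> holo_on (\<lambda>z. op (f z) (g z)) U"
  shows "hol_germ y (\<lambda>z. op (F z) (G z))"
proof -
  obtain U V f g where UV: "open U" "y \<in> U" "holo_on f U" "agree_near y F f"
    "open V" "y \<in> V" "holo_on g V" "agree_near y G g"
    using assms(1,2) unfolding hol_germ_def by blast
  show ?thesis
  proof (rule hol_germI)
    show "holo_on (\<lambda>z. op (f z) (g z)) (U \<inter> V)"
      using UV by (intro assms(3)) (auto elim: holo_on_subset)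
    show "agree_near y (\<lambda>z. op (F z) (G z)) (\<lambda>z. op (f z) (g z))"
      by (rule agree_near_combine[OF UV(4,8)]) simp
  qed (use UV in auto)
qed

lemma hol_germ_add: "hol_germ y F \<Longrightarrow> hol_germ y G \<Longrightarrow> hol_germ y (\<lambda>z. F z + G z)"
  by (rule hol_germ_binop[where op = "(+)"]) (auto intro: holo_on_add)

lemma hol_germ_mult: "hol_germ y F \<Longrightarrow> hol_germ y G \<Longrightarrow> hol_germ y (\<lambda>z. F z * G z)"
  by (rule hol_germ_binop[where op = "(*)"]) (auto intro: holo_on_mult)

lemma hol_germ_diff: "hol_germ y F \<Longrightarrow> hol_germ y G \<Longrightarrow> hol_germ y (\<lambda>z. F z - G z)"
  using hol_germ_add[OF _ hol_germ_mult[OF hol_germ_const[of y "-1"]], of F G] by simp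

lemma hol_germ_sum: "(\<And>a. a \<in> A \<Longrightarrow> hol_germ y (F a)) \<Longrightarrow> hol_germ y (\<lambda>z. \<Sum>a\<in>A. F a z)"
  by (induction A rule: infinite_finite_induct) (auto intro: hol_germ_const hol_germ_add)

lemma holo_on_divide:
  assumes "holo_on f U" "holo_on g U" "\<And>z. z \<in> U \<Longrightarrow> g z \<noteq> 0"
  shows "holo_on (\<lambda>z. f z / g z) U"
  unfolding holo_on_def
proof
  fix z assume z: "z \<in> U"
  then obtain D E where DE: "complex_functional D" "(f has_derivative D) (at z)"
    "complex_functional E" "(g has_derivative E) (at z)"
    using assms(1,2) unfolding holo_on_def by blast
  show "\<exists>D. complex_functional D \<and> ((\<lambda>z. f z / g z) has_derivative D) (at z)"
  proof (intro exI conjI)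
    show "((\<lambda>z. f z / g z) has_derivative (\<lambda>h. (D h * g z - f z * E h) / (g z * g z))) (at z)"
      using DE assms(3)[OF z] by (auto intro!: has_derivative_divide')
    show "complex_functional (\<lambda>h. (D h * g z - f z * E h) / (g z * g z))"
      using DE by (auto simp: complex_functional_iff algebra_simps diff_divide_distrib add_divide_distrib)
  qed
qed

lemma regular_at_imp_hol_germ:
  assumes "regular_at s y f" shows "hol_germ y f"
proof (cases s)
  case Analytic
  then show ?thesis using assms by (auto intro: hol_germI)
next
  case Algebraic
  then obtain p q where pq: "p \<in> poly_funs" "q \<in> poly_funs" "q y \<noteq> 0" "f = (\<lambda>z. p z / q z)"
    using assms by auto
  have "open {z. q z \<noteq> 0}"
    using continuous_on_poly_funs[OF pq(2)] by (intro open_Collect_neq continuous_intros)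
  then show ?thesis
    using pq holo_on_poly_funs by (intro hol_germI[of f "{z. q z \<noteq> 0}"]) (auto intro!: holo_on_divide)
qed

lemma agree_near_continuous_eq:
  fixes f g :: "'a::topological_space \<Rightarrow> 'b::t2_space"
  assumes "agree_near x f g" "open U" "x \<in> U" "continuous_on U f" "continuous_on U g"
  shows "f x = g x"
proof (rule ccontr)
  assume neq: "f x \<noteq> g x"
  obtain A B where AB: "open A" "open B" "f x \<in> A" "g x \<in> B" "A \<inter> B = {}"
    using hausdorff[OF neq] by blast
  obtain W D where WD: "open W" "x \<in> W" "open D" "W \<subseteq> closure D" "\<forall>z\<in>D. f z = g z"
    using assms(1) unfolding agree_near_iff by blast
  have "open (f -` A \<inter> U)" "open (g -` B \<inter> U)"
    using assms AB by (auto simp: continuous_on_open_vimage)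
  moreover have "x \<in> (f -` A \<inter> U) \<inter> (g -` B \<inter> U)" "x \<in> closure D" using assms AB WD by auto
  ultimately have "D \<inter> ((f -` A \<inter> U) \<inter> (g -` B \<inter> U)) \<noteq> {}"
    unfolding closure_iff_nhds_not_empty by blast
  then show False using WD(5) AB(5) by fastforce
qed

lemma agree_near_open:
  assumes "agree_near x f g"
  obtains W where "open W" "x \<in> W" "\<And>y. y \<in> W \<Longrightarrow> agree_near y f g"
  using assms unfolding agree_near_def by (meson open_interior)

text \<open>
  Two continuous functions with the same germ at a point have the same value there. So the value at
  \<open>y\<close> of a local holomorphic representative is independent of choices, and these values form a
  function that coincides with the representative chosen at \<open>y\<close> on a whole neighbourhood of \<open>y\<close>.
\<close>

lemma hol_germ_globalize:
  assumes "\<And>y. hol_germ y F"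
  obtains H where "holo_on H UNIV" "\<And>y. agree_near y F H"
proof -
  obtain U h where U: "\<And>y. open (U y)" "\<And>y. y \<in> U y" "\<And>y. holo_on (h y) (U y)"
    and h: "\<And>y. agree_near y F (h y)"
    using assms unfolding hol_germ_def by metis
  define H where "H y = h y y" for y
  have local: "\<exists>W. open W \<and> y \<in> W \<and> W \<subseteq> U y \<and> (\<forall>x\<in>W. H x = h y x)" for y
  proof -
    obtain W where W: "open W" "y \<in> W" "\<And>x. x \<in> W \<Longrightarrow> agree_near x F (h y)"
      using agree_near_open[OF h] by blast
    have "h x x = h y x" if "x \<in> W \<inter> U y" for x
    proof (rule agree_near_continuous_eq[of x "h x" "h y" "U x \<inter> U y"])
      show "agree_near x (h x) (h y)"
        using that by (intro agree_near_trans[OF agree_near_sym[OF h] W(3)]) auto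
      show "continuous_on (U x \<inter> U y) (h x)" "continuous_on (U x \<inter> U y) (h y)"
        using holo_on_continuous[OF U(3)] by (auto intro: continuous_on_subset)
    qed (use that U in auto)
    then show ?thesis using W U by (intro exI[of _ "W \<inter> U y"]) (auto simp: H_def)
  qed
  have "\<exists>D. complex_functional D \<and> (H has_derivative D) (at y)" for y
  proof -
    obtain W where W: "open W" "y \<in> W" "W \<subseteq> U y" "\<forall>x\<in>W. H x = h y x" using local by blast
    obtain D where "complex_functional D" "(h y has_derivative D) (at y)"
      using U(2,3)[of y] unfolding holo_on_def by blast
    then show ?thesis
      using W has_derivative_transform_within_open[of "h y" D y UNIV W H] by auto
  qed
  then have "holo_on H UNIV" by (simp add: holo_on_def)
  moreover have "agree_near y F H" for y
  proof -
    obtain W where W: "open W" "y \<in> W" "\<forall>x\<in>W. H x = h y x" using local by blast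
    have "agree_near y (h y) H"
      by (rule agree_nearI[OF W(1,2,1)]) (use W closure_subset in auto)
    with h show ?thesis by (rule agree_near_trans)
  qed
  ultimately show ?thesis by (rule that)
qed

lemma agree_near_everywhere_continuous_eq:
  fixes f g :: "'a::topological_space \<Rightarrow> 'b::t2_space"
  assumes "\<And>x. agree_near x f g" "continuous_on UNIV f" "continuous_on UNIV g"
  shows "f = g"
  using agree_near_continuous_eq[OF assms(1) open_UNIV _ assms(2,3)] by auto


section \<open>Meromorphic functions with holomorphic germs everywhere\<close>

lemma mero_eq_refl_iff: "mero_eq f f \<longleftrightarrow> (\<forall>x. mero_at x f)"
  by (auto simp: mero_eq_def)

lemma mero_eq_rep_mero: "mero_eq (rep_mero f) (rep_mero f)"
  using Quotient_rep_reflp[OF Quotient_mero] .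

lemma Mero_rep_mero: "Mero (rep_mero f) = f"
  using Quotient_abs_rep[OF Quotient_mero] .

lemma rep_Mero: "mero_eq f f \<Longrightarrow> mero_eq (rep_mero (Mero f)) f"
  using Quotient_rep_abs[OF Quotient_mero] .

lemma Mero_eqI: "mero_eq f g \<Longrightarrow> Mero f = Mero g"
  using Quotient_rel_abs[OF Quotient_mero] .

lemma mero_at_quotient_poly_funs:
  assumes "p \<in> poly_funs" "q \<in> poly_funs" "q \<noteq> (\<lambda>_. 0)"
  shows "mero_at x (\<lambda>z. p z / q z)"
  unfolding mero_at_def
  using assms poly_funs_zeros_interior_empty[OF assms(2,3)]
  by (intro exI[of _ UNIV] exI[of _ p] exI[of _ q]) (auto intro: holo_on_poly_funs)

lemma mero_at_holo: "holo_on f UNIV \<Longrightarrow> mero_at x f"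
  unfolding mero_at_def
  by (intro exI[of _ UNIV] exI[of _ f] exI[of _ "\<lambda>_. 1"]) (auto simp: holo_on_const)

text \<open>
  The local representatives glue to an entire function \<open>H\<close>. In the algebraic setting the given
  function is \<open>p / q\<close>; then \<open>q H = p\<close> on a dense set, hence everywhere, and \<open>H\<close> is a polynomial by
  \<open>continuous_quotient_poly_funs\<close>.
\<close>

lemma regular_functions_if_hol_germs:
  fixes f :: "'i::finite mero"
  assumes "f \<in> mero_functions s" "\<And>y. hol_germ y (rep_mero f)"
  shows "f \<in> regular_functions s"
proof -
  obtain H where H: "holo_on H UNIV" "\<And>y. agree_near y (rep_mero f) H"
    using hol_germ_globalize[OF assms(2)] by blast
  have "mero_eq (rep_mero f) H"
    using mero_eq_rep_mero[of f] H mero_at_holo by (auto simp: mero_eq_def)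
  then have f: "f = Mero H" using Mero_eqI Mero_rep_mero by metis
  show ?thesis
  proof (cases s)
    case Analytic
    then show ?thesis using f H by auto
  next
    case Algebraic
    then obtain p q where pq: "p \<in> poly_funs" "q \<in> poly_funs" "q \<noteq> (\<lambda>_. 0)"
      "f = Mero (\<lambda>z. p z / q z)" using assms(1) by auto
    have dense: "open {z. q z \<noteq> 0}" "UNIV \<subseteq> closure {z. q z \<noteq> 0}"
      using nonzero_open_dense[OF open_UNIV continuous_on_poly_funs[OF pq(2)]]
        poly_funs_zeros_interior_empty[OF pq(2,3)] by auto
    have cont: "continuous_on UNIV H" by (rule holo_on_continuous[OF H(1)])
    have "agree_near y (\<lambda>z. q z * H z) p" for y
    proof -
      have "agree_near y (rep_mero f) (\<lambda>z. p z / q z)"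
        using rep_Mero[of "\<lambda>z. p z / q z"] mero_at_quotient_poly_funs[OF pq(1-3)]
        by (auto simp: mero_eq_def pq(4))
      then have "agree_near y H (\<lambda>z. p z / q z)"
        by (rule agree_near_trans[OF agree_near_sym[OF H(2)]])
      then have "agree_near y (\<lambda>z. q z * H z) (\<lambda>z. q z * (p z / q z))"
        by (rule agree_near_combine[OF _ agree_near_refl]) simp
      moreover have "agree_near y (\<lambda>z. q z * (p z / q z)) p"
        by (rule agree_nearI[OF open_UNIV UNIV_I dense]) auto
      ultimately show ?thesis by (rule agree_near_trans)
    qed
    then have "(\<lambda>z. q z * H z) = p"
      by (rule agree_near_everywhere_continuous_eq)
         (intro continuous_intros cont continuous_on_poly_funs pq)+
    then have "H \<in> poly_funs"
      using continuous_quotient_poly_funs[OF pq(1-3) cont] by metis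
    then show ?thesis using f Algebraic by auto
  qed
qed

lemma times_poly_mero_functions:
  assumes "p \<in> poly_funs" "f \<in> mero_functions s"
  shows "Mero p * f \<in> mero_functions s"
proof (cases s)
  case Algebraic
  then obtain a b where ab: "a \<in> poly_funs" "b \<in> poly_funs" "b \<noteq> (\<lambda>_. 0)"
    "f = Mero (\<lambda>z. a z / b z)" using assms(2) by auto
  have "Mero p * f = Mero (\<lambda>z. p z * (a z / b z))"
    unfolding ab(4) using mero_at_quotient_poly_funs[OF ab(1-3)] mero_at_holo[OF holo_on_poly_funs[OF assms(1)]]
    by (intro times_mero.abs_eq) (auto simp: mero_eq_refl_iff)
  also have "(\<lambda>z. p z * (a z / b z)) = (\<lambda>z. (p z * a z) / b z)" by simp
  finally have "Mero p * f = Mero (\<lambda>z. (p z * a z) / b z)" .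
  moreover have "(\<lambda>z. p z * a z) \<in> poly_funs" by (intro poly_funs.mult assms(1) ab(1))
  ultimately show ?thesis using ab(2,3) unfolding Algebraic mero_functions.simps
    by (intro CollectI exI[of _ "\<lambda>z. p z * a z"] exI[of _ b] conjI)
qed simp

lemma rep_times_poly:
  assumes "p \<in> poly_funs"
  shows "agree_near y (rep_mero (Mero p * f)) (\<lambda>z. p z * rep_mero f z)"
proof -
  have "mero_eq p p" using assms by (auto simp: mero_eq_refl_iff intro: mero_at_holo holo_on_poly_funs)
  from times_mero.abs_eq[OF this mero_eq_rep_mero, of f]
  have "Mero p * f = Mero (\<lambda>z. p z * rep_mero f z)" by (simp add: Mero_rep_mero)
  moreover have "mero_eq (\<lambda>z. p z * rep_mero f z) (\<lambda>z. p z * rep_mero f z)"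
    using \<open>mero_eq p p\<close> mero_eq_rep_mero[of f] by (auto simp: mero_eq_refl_iff intro: mero_at_mult)
  ultimately show ?thesis using rep_Mero by (auto simp: mero_eq_def)
qed


section \<open>Separating the summands by power sums\<close>

text \<open>
  For \<open>a \<noteq> 0\<close> the polynomial \<open>(w - a)\<^sup>m\<^sup>+\<^sup>1 - w\<^sup>m\<^sup>+\<^sup>1\<close> has degree exactly \<open>m\<close>, with leading coefficient
  \<open>- (m + 1) a\<close>. These differences thus span all polynomials in \<open>w\<close>.
\<close>

lemma power_minus_shift:
  fixes a :: complex
  assumes "a \<noteq> 0"
  obtains K c where "\<And>w. w ^ m = K * (((w - a) ^ Suc m - w ^ Suc m) - (\<Sum>k<m. c k * w ^ k))"
proof -
  define c where "c k = of_nat (Suc m choose k) * (- a) ^ (Suc m - k)" for k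
  have "w ^ m = inverse (c m) * (((w - a) ^ Suc m - w ^ Suc m) - (\<Sum>k<m. c k * w ^ k))" for w
  proof -
    have "(w - a) ^ Suc m = (\<Sum>k\<le>Suc m. c k * w ^ k)"
      using binomial_ring[of w "- a" "Suc m"] by (simp add: c_def algebra_simps)
    also have "\<dots> = (\<Sum>k<m. c k * w ^ k) + c m * w ^ m + w ^ Suc m"
      by (simp add: c_def flip: lessThan_Suc_atMost)
    finally have "((w - a) ^ Suc m - w ^ Suc m) - (\<Sum>k<m. c k * w ^ k) = c m * w ^ m" by simp
    moreover have "c m = - (of_nat (Suc m) * a)" by (simp add: c_def)
    then have "c m \<noteq> 0" using assms by (simp del: of_nat_Suc)
    ultimately show ?thesis by simp
  qed
  then show ?thesis by (rule that)
qed

text \<open>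
  The heart of the argument. A shift along the \<open>j\<close>-th axis changes the power sum over \<open>B\<close> by
  \<open>(z\<^sub>j - a)\<^sup>r - z\<^sub>j\<^sup>r\<close>, a function of the single coordinate \<open>z\<^sub>j\<close>. As the unshifted power sum
  factors out of the sum, the hypothesis shows that \<open>\<Sum>\<^sub>j f\<^sub>j p(z\<^sub>j)\<close> is holomorphic for the differences
  \<open>p = (w - a)\<^sup>r - w\<^sup>r\<close>, and so for every polynomial \<open>p\<close> in one variable whose coefficients are
  holomorphic. The choice \<open>p = \<Prod>\<^sub>l (w - z\<^sub>l)\<close> over \<open>l \<in> B - {i}\<close> kills every summand but the \<open>i\<close>-th.
\<close>

lemma hol_germ_separate:
  fixes f :: "'i::finite \<Rightarrow> complex ^ 'i \<Rightarrow> complex"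
  assumes a: "a \<noteq> 0" and J: "J \<subseteq> B" "i \<in> J"
    and psum: "\<And>r. hol_germ y (\<lambda>z. \<Sum>j\<in>J. f j z * (\<Sum>l\<in>B. ((z - axis j a) $ l) ^ r))"
  shows "hol_germ y (\<lambda>z. f i z * (\<Prod>l\<in>B-{i}. z $ i - z $ l))"
proof -
  have coord: "hol_germ y (\<lambda>z. z $ l)" for l
    by (intro hol_germ_poly_funs poly_funs.coord)
  have "B \<noteq> {}" using J by auto
  \<comment> \<open>The zeroth power sum counts the elements of \<open>B\<close>.\<close>
  have total: "hol_germ y (\<lambda>z. \<Sum>j\<in>J. f j z)"
  proof -
    have "hol_germ y (\<lambda>z. inverse (of_nat (card B)) * (\<Sum>j\<in>J. f j z * (\<Sum>l\<in>B. ((z - axis j a) $ l) ^ 0)))"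
      by (intro hol_germ_mult hol_germ_const psum)
    moreover have "inverse (of_nat (card B)) * (\<Sum>j\<in>J. f j z * (\<Sum>l\<in>B. ((z - axis j a) $ l) ^ 0)) =
        (\<Sum>j\<in>J. f j z)" for z
    proof -
      have "(\<Sum>j\<in>J. f j z * (\<Sum>l\<in>B. ((z - axis j a) $ l) ^ 0)) = (\<Sum>j\<in>J. f j z) * of_nat (card B)"
        unfolding sum_distrib_right by simp
      then show ?thesis using \<open>B \<noteq> {}\<close> by simp
    qed
    ultimately show ?thesis by simp
  qed
  have shift: "hol_germ y (\<lambda>z. \<Sum>j\<in>J. f j z * ((z $ j - a) ^ r - (z $ j) ^ r))" for r
  proof -
    have "(\<Sum>l\<in>B. ((z - axis j a) $ l) ^ r) - (\<Sum>l\<in>B. (z $ l) ^ r) = (z $ j - a) ^ r - (z $ j) ^ r"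
      if "j \<in> J" for j z
    proof -
      have "j \<in> B" using that J by auto
      then have "(\<Sum>l\<in>B. ((z - axis j a) $ l) ^ r) = (z $ j - a) ^ r + (\<Sum>l\<in>B-{j}. (z $ l) ^ r)"
        "(\<Sum>l\<in>B. (z $ l) ^ r) = (z $ j) ^ r + (\<Sum>l\<in>B-{j}. (z $ l) ^ r)"
        by (auto simp: sum.remove axis_def intro!: sum.cong)
      then show ?thesis by simp
    qed
    then have "(\<lambda>z. \<Sum>j\<in>J. f j z * ((z $ j - a) ^ r - (z $ j) ^ r)) =
        (\<lambda>z. (\<Sum>j\<in>J. f j z * (\<Sum>l\<in>B. ((z - axis j a) $ l) ^ r)) - (\<Sum>j\<in>J. f j z) * (\<Sum>l\<in>B. (z $ l) ^ r))"
      by (auto simp: fun_eq_iff sum_distrib_right sum_subtractf[symmetric] right_diff_distrib[symmetric]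
          intro!: sum.cong)
    moreover have "hol_germ y \<dots>"
      by (intro hol_germ_diff hol_germ_mult psum total hol_germ_poly_funs poly_funs_sum
          poly_funs_power poly_funs.coord)
    ultimately show ?thesis by simp
  qed
  have moment: "hol_germ y (\<lambda>z. \<Sum>j\<in>J. f j z * (z $ j) ^ m)" for m
  proof (induction m rule: less_induct)
    case (less m)
    obtain K c where
      Kc: "\<And>w. w ^ m = K * (((w - a) ^ Suc m - w ^ Suc m) - (\<Sum>k<m. c k * w ^ k))"
      using power_minus_shift[OF a] by blast
    have eq: "(\<Sum>j\<in>J. f j z * (z $ j) ^ m) = K * ((\<Sum>j\<in>J. f j z * ((z $ j - a) ^ Suc m - (z $ j) ^ Suc m)) -
        (\<Sum>k<m. c k * (\<Sum>j\<in>J. f j z * (z $ j) ^ k)))" for z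
    proof -
      have "(\<Sum>k<m. c k * (\<Sum>j\<in>J. f j z * (z $ j) ^ k)) = (\<Sum>j\<in>J. f j z * (\<Sum>k<m. c k * (z $ j) ^ k))"
        unfolding sum_distrib_left by (subst sum.swap) (simp add: mult_ac)
      moreover have "(\<Sum>j\<in>J. f j z * (z $ j) ^ m) = (\<Sum>j\<in>J. K *
          (f j z * ((z $ j - a) ^ Suc m - (z $ j) ^ Suc m) - f j z * (\<Sum>k<m. c k * (z $ j) ^ k)))"
        by (intro sum.cong refl, subst Kc) (simp only: right_diff_distrib mult.left_commute)
      moreover have "(\<Sum>j\<in>J. K * (u j - v j)) = K * ((\<Sum>j\<in>J. u j) - (\<Sum>j\<in>J. v j))"
        for u v :: "'i \<Rightarrow> complex"
        by (simp add: sum_distrib_left sum_subtractf right_diff_distrib)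
      ultimately show ?thesis by (simp only:)
    qed
    show ?case
      unfolding eq
      by (intro hol_germ_mult hol_germ_diff hol_germ_const hol_germ_sum shift less.IH) simp
  qed
  \<comment> \<open>Multiplying the test polynomial by one more factor \<open>w - z\<^sub>l\<close> raises the exponent of \<open>w\<close> in one
    summand and brings the holomorphic factor \<open>z\<^sub>l\<close> in the other; so \<open>m\<close> has to be arbitrary.\<close>
  have "hol_germ y (\<lambda>z. \<Sum>j\<in>J. f j z * ((z $ j) ^ m * (\<Prod>l\<in>L. z $ j - z $ l)))" if "finite L" for L m
    using that
  proof (induction L arbitrary: m)
    case empty
    show ?case using moment by simp
  next
    case (insert l L)
    have eq: "(\<Sum>j\<in>J. f j z * ((z $ j) ^ m * (\<Prod>l\<in>insert l L. z $ j - z $ l))) =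
        (\<Sum>j\<in>J. f j z * ((z $ j) ^ Suc m * (\<Prod>l\<in>L. z $ j - z $ l))) -
        z $ l * (\<Sum>j\<in>J. f j z * ((z $ j) ^ m * (\<Prod>l\<in>L. z $ j - z $ l)))" for z
      using insert.hyps
      by (simp add: sum_distrib_left algebra_simps flip: sum_subtractf)
    show ?case
      unfolding eq by (intro hol_germ_mult hol_germ_diff coord insert.IH)
  qed
  from this[of "B - {i}" 0]
  have "hol_germ y (\<lambda>z. \<Sum>j\<in>J. f j z * (\<Prod>l\<in>B-{i}. z $ j - z $ l))" by simp
  moreover have "(\<Sum>j\<in>J. f j z * (\<Prod>l\<in>B-{i}. z $ j - z $ l)) = f i z * (\<Prod>l\<in>B-{i}. z $ i - z $ l)" for z
  proof -
    have "(\<Sum>j\<in>J. f j z * (\<Prod>l\<in>B-{i}. z $ j - z $ l)) = (\<Sum>j\<in>{i}. f j z * (\<Prod>l\<in>B-{i}. z $ j - z $ l))"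
      using J by (intro sum.mono_neutral_right) auto
    then show ?thesis by simp
  qed
  ultimately show ?thesis by simp
qed


section \<open>Orbits of the product of symmetric groups\<close>

definition block :: "('i::finite \<Rightarrow> nat \<times> nat) \<Rightarrow> 'i \<Rightarrow> 'i set" where
  "block lab i = {l. fst (lab l) = fst (lab i)}"

lemma apply_inverse_cancel [simp]:
  "Perm.apply g (Perm.apply (inverse g) i) = i" "Perm.apply (inverse g) (Perm.apply g i) = i"
  by (simp_all add: apply_inverse bij_is_surj bij_is_inj surj_f_inv_f)

lemma Gp_inverse:
  assumes "g \<in> Gp lab" shows "inverse g \<in> Gp lab"
proof -
  have "fst (lab (Perm.apply g (Perm.apply (inverse g) i))) = fst (lab (Perm.apply (inverse g) i))" for i
    using assms unfolding Gp_def by blast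
  then show ?thesis by (simp add: Gp_def)
qed

lemma Gp_times: "g \<in> Gp lab \<Longrightarrow> h \<in> Gp lab \<Longrightarrow> g * h \<in> Gp lab"
  by (auto simp: Gp_def apply_times)

lemma Gp_one: "1 \<in> Gp lab"
  by (auto simp: Gp_def)

lemma finite_perm: "finite (X :: 'i::finite perm set)"
  by (rule inj_on_finite[of Perm.apply X UNIV]) (auto simp: inj_on_def intro: perm_eqI)

lemma vact_nth: "vact g v $ i = v $ Perm.apply (inverse g) i"
  by (simp add: vact_def)

lemma vact_times: "vact (g * h) v = vact g (vact h v)"
  by (simp add: vec_eq_iff vact_nth apply_times apply_inverse o_inv_distrib)

lemma vact_one [simp]: "vact 1 v = v"
  by (simp add: vec_eq_iff vact_nth)

lemma vact_axis: "vact g (axis i a) = axis (Perm.apply g i) a"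
proof -
  have "Perm.apply (inverse g) l = i \<longleftrightarrow> l = Perm.apply g i" for l by auto
  then show ?thesis by (auto simp: vec_eq_iff vact_nth axis_def)
qed

lemma bij_betw_block:
  assumes "g \<in> Gp lab" shows "bij_betw (Perm.apply g) (block lab i) (block lab i)"
  by (rule bij_betw_byWitness[where f' = "Perm.apply (inverse g)"])
     (use assms Gp_inverse[OF assms] in \<open>auto simp: block_def Gp_def\<close>)

definition power_sum :: "('i::finite \<Rightarrow> nat \<times> nat) \<Rightarrow> 'i \<Rightarrow> nat \<Rightarrow> complex ^ 'i \<Rightarrow> complex" where
  "power_sum lab i r z = (\<Sum>l\<in>block lab i. (z $ l) ^ r)"

lemma power_sum_vact: "g \<in> Gp lab \<Longrightarrow> power_sum lab i r (vact g z) = power_sum lab i r z"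
  unfolding power_sum_def vact_nth
  by (rule sum.reindex_bij_betw[OF bij_betw_block[OF Gp_inverse]])

lemma poly_funs_power_sum: "power_sum lab i r \<in> poly_funs"
  unfolding power_sum_def[abs_def] by (intro poly_funs_sum poly_funs_power poly_funs.coord)

text \<open>
  The sum of the coordinates in a block is constant on orbits. Comparing these sums for
  \<open>y - a \<delta>\<^sub>i\<close> and \<open>y - b \<delta>\<^sub>j\<close> shows that the two shifts have the same length, and that the shift
  takes place in the same block unless it is zero.
\<close>

lemma axis_in_orbit_of_difference:
  assumes g: "g \<in> Gp lab" and eq: "y - axis j b = vact g (y - axis i a)"
  shows "axis j b = axis i a \<or> (a \<noteq> 0 \<and> b = a \<and> j \<in> block lab i)"
proof -
  define bs where "bs k v = power_sum lab k 1 v" for k v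
  have bs_axis: "bs k (axis l c) = (if l \<in> block lab k then c else 0)" for k l c
    by (simp add: bs_def power_sum_def axis_def)
  have "bs k (y - v) = bs k y - bs k v" for k v
    by (simp add: bs_def power_sum_def sum_subtractf)
  moreover have "bs k (y - axis j b) = bs k (y - axis i a)" for k
    unfolding eq bs_def by (rule power_sum_vact[OF g])
  ultimately have sums: "bs k (axis j b) = bs k (axis i a)" for k by simp
  have self: "l \<in> block lab l" for l by (simp add: block_def)
  show ?thesis
  proof (cases "a = 0")
    case True
    with sums[of j] have "b = 0" by (simp add: bs_axis self)
    with True show ?thesis by (simp add: vec_eq_iff axis_def)
  next
    case False
    with sums[of i] show ?thesis by (auto simp: bs_axis self split: if_splits)
  qed
qed


section \<open>The direct sum of germs\<close>

lift_definition germ_holomorphic :: "complex ^ 'i::finite \<Rightarrow> 'i germs \<Rightarrow> bool" is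
  "\<lambda>x F. hol_germ x (F x)"
  using hol_germ_cong agree_near_sym by (fastforce simp: germ_eq_def)

lemma germ_holomorphic_zero: "germ_holomorphic x 0"
  by transfer (rule hol_germ_const)

lemma germ_holomorphic_add:
  "germ_holomorphic x F \<Longrightarrow> germ_holomorphic x F' \<Longrightarrow> germ_holomorphic x (F + F')"
  by transfer (rule hol_germ_add)

lemma germ_holomorphic_sum:
  "(\<And>a. a \<in> W \<Longrightarrow> germ_holomorphic x (u a)) \<Longrightarrow> germ_holomorphic x (\<Sum>a\<in>W. u a)"
  by (induction W rule: infinite_finite_induct) (auto intro: germ_holomorphic_zero germ_holomorphic_add)

lemma germ_regular_imp_holomorphic: "germ_regular s x F \<Longrightarrow> germ_holomorphic x F"
  by transfer (use regular_at_imp_hol_germ hol_germ_cong agree_near_sym in blast)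

lemma not_in_germ_support_imp_holomorphic: "x \<notin> germ_support F \<Longrightarrow> germ_holomorphic x F"
  by transfer (use hol_germ_cong[OF hol_germ_const agree_near_sym] in blast)

lemma O_total_imp_holomorphic:
  assumes "F \<in> O_total s lab" shows "germ_holomorphic x F"
proof -
  obtain W u where "F = (\<Sum>\<omega>\<in>W. u \<omega>)" "\<forall>\<omega>\<in>W. u \<omega> \<in> O_inv s lab \<omega>"
    using assms unfolding O_total_def by blast
  moreover have "germ_holomorphic x G" if "G \<in> O_inv s lab \<omega>" for G \<omega>
    using that germ_regular_imp_holomorphic not_in_germ_support_imp_holomorphic
    unfolding O_inv_def by blast
  ultimately show ?thesis by (auto intro: germ_holomorphic_sum)
qed

lemma germ_eq_refl_iff: "germ_eq F F \<longleftrightarrow> germ_family F"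
  by (simp add: germ_eq_def)

lemma germ_holomorphic_abs:
  "germ_family R \<Longrightarrow> germ_holomorphic x (abs_germs R) \<longleftrightarrow> hol_germ x (R x)"
  by (simp add: germ_holomorphic.abs_eq germ_eq_refl_iff)

lemma sum_abs_germs:
  assumes "\<And>a. a \<in> K \<Longrightarrow> germ_family (R a)"
  shows "germ_family (\<lambda>x z. \<Sum>a\<in>K. R a x z) \<and>
    (\<Sum>a\<in>K. abs_germs (R a)) = abs_germs (\<lambda>x z. \<Sum>a\<in>K. R a x z)"
  using assms
proof (induction K rule: infinite_finite_induct)
  case (insert a K)
  then have IH: "germ_family (R a)" "germ_family (\<lambda>x z. \<Sum>a\<in>K. R a x z)"
    "(\<Sum>a\<in>K. abs_germs (R a)) = abs_germs (\<lambda>x z. \<Sum>a\<in>K. R a x z)" by auto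
  then show ?case
    using insert.hyps plus_germs.abs_eq[of "R a" "\<lambda>x z. \<Sum>a\<in>K. R a x z"] germ_family_add[OF IH(1,2)]
    by (simp add: germ_eq_refl_iff)
qed (simp_all add: germ_family_zero zero_germs_def)

lemma skew_apply_abs:
  fixes X :: "'i::finite skew"
  assumes R: "germ_family R"
  defines "R' \<equiv> \<lambda>y z. \<Sum>\<xi>\<in>Poly_Mapping.keys X. rep_mero (Poly_Mapping.lookup X \<xi>) z * R (y - \<xi>) (z - \<xi>)"
  shows "germ_family R'" "skew_apply X (abs_germs R) = abs_germs R'"
proof -
  have fam: "germ_family (\<lambda>y z. rep_mero (Poly_Mapping.lookup X \<xi>) z * R (y - \<xi>) (z - \<xi>))" for \<xi>
    using mero_eq_rep_mero[of "Poly_Mapping.lookup X \<xi>"]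
    by (intro germ_family_term R) (simp add: mero_eq_refl_iff)
  have "term_apply (Poly_Mapping.lookup X \<xi>) \<xi> (abs_germs R) =
      abs_germs (\<lambda>y z. rep_mero (Poly_Mapping.lookup X \<xi>) z * R (y - \<xi>) (z - \<xi>))" for \<xi>
    using term_apply.abs_eq[OF mero_eq_rep_mero, of R "Poly_Mapping.lookup X \<xi>" \<xi>] R
    by (simp add: Mero_rep_mero germ_eq_refl_iff)
  then show "germ_family R'" "skew_apply X (abs_germs R) = abs_germs R'"
    using sum_abs_germs[where K = "Poly_Mapping.keys X", OF fam] by (simp_all add: skew_apply_def R'_def)
qed

definition orbit_of :: "('i::finite \<Rightarrow> nat \<times> nat) \<Rightarrow> complex ^ 'i \<Rightarrow> (complex ^ 'i) set" where
  "orbit_of lab x = (\<lambda>g. vact g x) ` Gp lab"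

lemma orbit_of_self: "x \<in> orbit_of lab x"
  unfolding orbit_of_def using Gp_one by force

lemma vact_in_orbit_of_iff:
  assumes "g \<in> Gp lab" shows "vact g w \<in> orbit_of lab x \<longleftrightarrow> w \<in> orbit_of lab x"
proof
  have *: "vact h v \<in> orbit_of lab x" if "h \<in> Gp lab" "v \<in> orbit_of lab x" for h v
    using that unfolding orbit_of_def by (auto simp flip: vact_times intro: Gp_times)
  show "vact g w \<in> orbit_of lab x" if "w \<in> orbit_of lab x" using * assms that by blast
  show "w \<in> orbit_of lab x" if "vact g w \<in> orbit_of lab x"
    using *[OF Gp_inverse[OF assms] that] by simp
qed

text \<open>
  The germs of one function \<open>P\<close> at the points of a single orbit. Invariant polynomials \<open>P\<close> give
  sufficiently many elements of \<open>O_total\<close> to test an operator, while the restriction to one orbit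
  selects the terms of the operator that are to be compared.
\<close>

definition on_orbit :: "(complex ^ 'i::finite) set \<Rightarrow> (complex ^ 'i \<Rightarrow> complex) \<Rightarrow>
    complex ^ 'i \<Rightarrow> complex ^ 'i \<Rightarrow> complex" where
  "on_orbit \<omega> P x z = (if x \<in> \<omega> then P z else 0)"

lemma on_orbit_germ [simp]:
  "x \<in> \<omega> \<Longrightarrow> on_orbit \<omega> P x = P" "x \<notin> \<omega> \<Longrightarrow> on_orbit \<omega> P x = (\<lambda>_. 0)"
  by (simp_all add: on_orbit_def fun_eq_iff)

lemma germ_family_on_orbit:
  assumes "P \<in> poly_funs"
  shows "germ_family (on_orbit (orbit_of lab x) P)"
proof -
  have "agree_near w (on_orbit (orbit_of lab x) P w) (\<lambda>_. 0)" if "w \<notin> orbit_of lab x" for w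
    using that by simp
  then have "{w. \<not> agree_near w (on_orbit (orbit_of lab x) P w) (\<lambda>_. 0)} \<subseteq> orbit_of lab x"
    by blast
  moreover have "finite (orbit_of lab x)" by (simp add: orbit_of_def finite_perm)
  moreover have "mero_at w (on_orbit (orbit_of lab x) P w)" for w
    using assms by (cases "w \<in> orbit_of lab x")
      (auto simp: mero_at_const intro: mero_at_holo holo_on_poly_funs)
  ultimately show ?thesis by (auto simp: germ_family_def intro: finite_subset)
qed

lemma regular_at_poly_funs: "p \<in> poly_funs \<Longrightarrow> regular_at s x p"
proof (cases s)
  case Algebraic
  assume "p \<in> poly_funs"
  then show ?thesis
    unfolding Algebraic regular_at.simps
    by (intro exI[of _ p] exI[of _ "\<lambda>_. 1"]) (auto intro: poly_funs.const)
qed (auto intro: holo_on_poly_funs)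

lemma abs_on_orbit_in_O_total:
  fixes P :: "complex ^ 'i::finite \<Rightarrow> complex"
  assumes P: "P \<in> poly_funs" and inv: "\<And>g z. g \<in> Gp lab \<Longrightarrow> P (vact g z) = P z"
  shows "abs_germs (on_orbit (orbit_of lab x) P) \<in> O_total s lab"
proof -
  let ?R = "on_orbit (orbit_of lab x) P"
  have R: "germ_eq ?R ?R" using germ_family_on_orbit[OF P] by (simp add: germ_eq_refl_iff)
  have "agree_near w (?R w) (\<lambda>_. 0)" if "w \<notin> orbit_of lab x" for w
    using that by simp
  then have "germ_support (abs_germs ?R) \<subseteq> orbit_of lab x"
    unfolding germ_support.abs_eq[OF R] by blast
  moreover have "germ_regular s w (abs_germs ?R)" if "w \<in> orbit_of lab x" for w
    unfolding germ_regular.abs_eq[OF R]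
    using that regular_at_poly_funs[OF P] by (intro exI[of _ P]) simp
  moreover have "germ_act g (abs_germs ?R) = abs_germs ?R" if "g \<in> Gp lab" for g
  proof -
    have "(\<lambda>y z. ?R (vact (inverse g) y) (vact (inverse g) z)) = ?R"
      using Gp_inverse[OF that] by (simp add: on_orbit_def fun_eq_iff vact_in_orbit_of_iff inv)
    then show ?thesis unfolding germ_act.abs_eq[OF R] by simp
  qed
  ultimately have "abs_germs ?R \<in> O_inv s lab (orbit_of lab x)"
    unfolding O_inv_def by blast
  moreover have "orbit_of lab x \<in> orbits lab" unfolding orbits_def orbit_of_def by blast
  ultimately show ?thesis
    unfolding O_total_def
    by (intro CollectI exI[of _ "{orbit_of lab x}"] exI[of _ "\<lambda>_. abs_germs ?R"]) auto
qed

text \<open>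
  At \<open>y\<close> the term of \<open>X\<close> with shift \<open>\<xi>\<close> sees the germ at \<open>y - \<xi>\<close>. Applied to \<open>P\<close> placed on one
  orbit, \<open>X\<close> therefore yields at \<open>y\<close> the partial sum over the shifts that lead from this orbit
  to \<open>y\<close>.
\<close>

lemma hol_germ_of_preserving:
  fixes X :: "'i::finite skew"
  assumes pres: "skew_apply X ` O_total s lab \<subseteq> O_total s lab"
    and P: "P \<in> poly_funs" "\<And>g z. g \<in> Gp lab \<Longrightarrow> P (vact g z) = P z"
  shows "hol_germ y (\<lambda>z. \<Sum>\<xi>\<in>{\<xi> \<in> Poly_Mapping.keys X. y - \<xi> \<in> orbit_of lab x}.
      rep_mero (Poly_Mapping.lookup X \<xi>) z * P (z - \<xi>))"
proof -
  note fam = germ_family_on_orbit[OF P(1), of lab x]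
  have "skew_apply X (abs_germs (on_orbit (orbit_of lab x) P)) \<in> O_total s lab"
    using pres abs_on_orbit_in_O_total[OF P] by blast
  then have "germ_holomorphic y (skew_apply X (abs_germs (on_orbit (orbit_of lab x) P)))"
    by (rule O_total_imp_holomorphic)
  then have "hol_germ y (\<lambda>z. \<Sum>\<xi>\<in>Poly_Mapping.keys X. rep_mero (Poly_Mapping.lookup X \<xi>) z *
      on_orbit (orbit_of lab x) P (y - \<xi>) (z - \<xi>))"
    unfolding skew_apply_abs(2)[OF fam] germ_holomorphic_abs[OF skew_apply_abs(1)[OF fam]] .
  also have "(\<lambda>z. \<Sum>\<xi>\<in>Poly_Mapping.keys X. rep_mero (Poly_Mapping.lookup X \<xi>) z *
      on_orbit (orbit_of lab x) P (y - \<xi>) (z - \<xi>)) =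
    (\<lambda>z. \<Sum>\<xi>\<in>{\<xi> \<in> Poly_Mapping.keys X. y - \<xi> \<in> orbit_of lab x}.
      rep_mero (Poly_Mapping.lookup X \<xi>) z * P (z - \<xi>))"
    by (auto simp: fun_eq_iff on_orbit_def sum.inter_filter intro!: sum.cong)
  finally show ?thesis .
qed

text \<open>
  Standard elements have this property, since permuting coordinates maps multiples of basis vectors
  to multiples of basis vectors.
\<close>

definition axis_supported :: "'i::finite skew \<Rightarrow> bool" where
  "axis_supported X \<longleftrightarrow> (\<forall>\<xi>. Poly_Mapping.lookup X \<xi> \<noteq> 0 \<longrightarrow> (\<exists>i a. \<xi> = axis i a))"

lemma hol_germ_zero_mero: "hol_germ y (rep_mero 0)"
proof -
  have "mero_eq (\<lambda>_::complex^'a. 0) (\<lambda>_. 0)" by (simp add: mero_eq_refl_iff mero_at_const)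
  from rep_Mero[OF this] have "agree_near y (rep_mero 0) (\<lambda>_. 0)"
    by (simp add: mero_eq_def zero_mero_def)
  from hol_germ_cong[OF hol_germ_const agree_near_sym[OF this]] show ?thesis .
qed

text \<open>
  Testing \<open>X\<close> on the orbit of \<open>y - a \<delta>\<^sub>i\<close> leaves at \<open>y\<close> only terms with shift \<open>a \<delta>\<^sub>j\<close>, \<open>j\<close> in the block
  of \<open>i\<close>. Using all power sums of that block as test functions, \<open>hol_germ_separate\<close> isolates the
  coefficient of the shift \<open>a \<delta>\<^sub>i\<close>, at the cost of the product of the \<open>z\<^sub>i - z\<^sub>l\<close>.
\<close>

lemma hol_germ_coefficient:
  fixes X :: "'i::finite skew"
  assumes pres: "skew_apply X ` O_total s lab \<subseteq> O_total s lab" and X: "axis_supported X"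
  shows "hol_germ y (\<lambda>z. rep_mero (Poly_Mapping.lookup X (axis i a)) z *
    (\<Prod>l\<in>block lab i - {i}. z $ i - z $ l))"
proof -
  have prod: "hol_germ y (\<lambda>z. \<Prod>l\<in>block lab i - {i}. z $ i - z $ l)"
    by (intro hol_germ_poly_funs poly_funs_prod poly_funs_minus poly_funs.coord)
  show ?thesis
  proof (cases "axis i a \<in> Poly_Mapping.keys X")
    case False
    then have "Poly_Mapping.lookup X (axis i a) = 0" by (simp add: in_keys_iff)
    then show ?thesis using hol_germ_mult[OF hol_germ_zero_mero prod] by simp
  next
    case True
    let ?f = "\<lambda>\<xi>. rep_mero (Poly_Mapping.lookup X \<xi>)"
    \<comment> \<open>The shifts of \<open>X\<close> that lead from the orbit of \<open>y - a \<delta>\<^sub>i\<close> to \<open>y\<close>.\<close>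
    define S where "S = {\<xi> \<in> Poly_Mapping.keys X. y - \<xi> \<in> orbit_of lab (y - axis i a)}"
    have sums: "hol_germ y (\<lambda>z. \<Sum>\<xi>\<in>S. ?f \<xi> z * power_sum lab i r (z - \<xi>))" for r
      unfolding S_def by (rule hol_germ_of_preserving[OF pres poly_funs_power_sum power_sum_vact])
    have S: "axis i a \<in> S" using True by (simp add: S_def orbit_of_self)
    have S_cases: "\<xi> = axis i a \<or> (a \<noteq> 0 \<and> (\<exists>j\<in>block lab i. \<xi> = axis j a))" if in_S: "\<xi> \<in> S" for \<xi>
    proof -
      obtain j b where \<xi>: "\<xi> = axis j b"
        using in_S X by (auto simp: S_def axis_supported_def in_keys_iff)
      obtain g where "g \<in> Gp lab" "y - axis j b = vact g (y - axis i a)"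
        using in_S by (auto simp: S_def orbit_of_def \<xi>)
      from axis_in_orbit_of_difference[OF this] show ?thesis by (auto simp: \<xi>)
    qed
    show ?thesis
    proof (cases "a = 0")
      case True
      \<comment> \<open>Without a shift there is only one term, and the test function \<open>1\<close> suffices.\<close>
      with S S_cases have "S = {axis i a}" by blast
      moreover have "hol_germ y (\<lambda>z. \<Sum>\<xi>\<in>S. ?f \<xi> z * 1)"
        unfolding S_def by (rule hol_germ_of_preserving[OF pres poly_funs.const]) simp
      ultimately have "hol_germ y (?f (axis i a))" by simp
      then show ?thesis by (rule hol_germ_mult[OF _ prod])
    next
      case False
      define J where "J = {j \<in> block lab i. axis j a \<in> S}"
      have self: "i \<in> block lab i" by (simp add: block_def)
      have "inj_on (\<lambda>j. axis j a) J" using False by (simp add: inj_on_def axis_eq_axis)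
      moreover have "(\<lambda>j. axis j a) ` J = S" unfolding J_def using S_cases self by blast
      ultimately have "bij_betw (\<lambda>j. axis j a) J S" by (simp add: bij_betw_def)
      then have "(\<Sum>j\<in>J. ?f (axis j a) z * power_sum lab i r (z - axis j a)) =
          (\<Sum>\<xi>\<in>S. ?f \<xi> z * power_sum lab i r (z - \<xi>))" for r z
        by (rule sum.reindex_bij_betw)
      with sums have "hol_germ y (\<lambda>z. \<Sum>j\<in>J. ?f (axis j a) z * power_sum lab i r (z - axis j a))" for r
        by simp
      then show ?thesis
        unfolding power_sum_def
        by (intro hol_germ_separate[OF False, of J "block lab i" i y "\<lambda>j. ?f (axis j a)"])
           (use S self in \<open>auto simp: J_def\<close>)
    qed
  qed
qed


section \<open>The sign character and its relative invariant\<close>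

definition sign_char :: "'i::finite perm \<Rightarrow> complex" where
  "sign_char g = of_int (sign (Perm.apply g))"

lemma apply_permutes_UNIV: "Perm.apply g permutes UNIV"
  by (rule bij_imp_permutes) simp_all

lemma permutation_apply: "permutation (Perm.apply (g :: 'i::finite perm))"
  unfolding permutation_permutes by (intro exI[of _ UNIV] conjI finite apply_permutes_UNIV)

lemma is_character_sign_char: "is_character lab sign_char"
proof -
  have "sign_char g \<noteq> 0" for g :: "'a perm" by (simp add: sign_char_def sign_def)
  moreover have "sign_char (g * h) = sign_char g * sign_char h" for g h :: "'a perm"
    by (simp add: sign_char_def apply_times sign_compose permutation_apply)
  ultimately show ?thesis by (simp add: is_character_def)
qed

text \<open>
  The exponents \<open>a_H\<close> are defined through this determinant; for the sign character they compare
  \<open>sign_char\<close> with its own powers.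
\<close>

lemma det_vact: "det (transpose (matrix (vact g))) = sign_char g"
proof -
  \<comment> \<open>The permutation matrix arises from the unit matrix by permuting its rows.\<close>
  have "matrix (vact g) = (\<chi> k. (mat 1 :: complex ^ 'a ^ 'a) $ Perm.apply (inverse g) k)"
    by (simp add: matrix_def vec_eq_iff vact_nth mat_def axis_def)
  then have "det (matrix (vact g)) = of_int (sign (Perm.apply (inverse g)))"
    by (simp add: det_permute_rows[OF apply_permutes_UNIV])
  then show ?thesis
    by (simp add: det_transpose sign_char_def apply_inverse sign_inverse permutation_apply)
qed

definition diagonal :: "'i::finite \<Rightarrow> 'i \<Rightarrow> (complex ^ 'i) set" where
  "diagonal i l = {v. v $ i = v $ l}"

lemma fixed_space_swap: "fixed_space (Perm.swap i l) = diagonal i l"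
proof -
  have "v \<in> fixed_space (Perm.swap i l) \<longleftrightarrow> (\<forall>m. v $ Perm.apply (Perm.swap i l) m = v $ m)"
    for v :: "complex ^ 'a"
    by (simp add: fixed_space_def vec_eq_iff vact_nth)
  moreover have "(\<forall>m. v $ Perm.apply (Perm.swap i l) m = v $ m) \<longleftrightarrow> v $ i = v $ l"
    for v :: "complex ^ 'a"
  proof
    assume eq: "v $ i = v $ l"
    show "\<forall>m. v $ Perm.apply (Perm.swap i l) m = v $ m"
    proof
      fix m
      show "v $ Perm.apply (Perm.swap i l) m = v $ m"
        using eq by (cases "m = i"; cases "m = l") auto
    qed
  qed (metis apply_swap_simp(2))
  ultimately show ?thesis by (auto simp: diagonal_def)
qed

lemma swap_in_Gp: "l \<in> block lab i \<Longrightarrow> Perm.swap i l \<in> Gp lab"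
  unfolding Gp_def
proof (intro CollectI allI)
  fix m assume "l \<in> block lab i"
  then show "fst (lab (Perm.apply (Perm.swap i l) m)) = fst (lab m)"
    by (cases "m = i"; cases "m = l") (auto simp: block_def)
qed

lemma axis_in_diagonal_iff: "i \<noteq> l \<Longrightarrow> axis m 1 \<in> diagonal i l \<longleftrightarrow> m \<noteq> i \<and> m \<noteq> l"
  by (auto simp: diagonal_def axis_def)

lemma complex_functional_diagonal:
  "complex_functional (\<lambda>v :: complex ^ 'i::finite. v $ i - v $ l)"
  by (simp add: complex_functional_iff algebra_simps)

lemma diagonal_in_reflection_hyperplanes:
  assumes "l \<in> block lab i" "l \<noteq> i"
  shows "diagonal i l \<in> reflection_hyperplanes lab"
proof -
  have "(\<lambda>v :: complex ^ 'a. v $ i - v $ l) \<noteq> (\<lambda>_. 0)"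
  proof
    assume "(\<lambda>v :: complex ^ 'a. v $ i - v $ l) = (\<lambda>_. 0)"
    from fun_cong[OF this, of "axis i 1"] assms(2) show False by (simp add: axis_def)
  qed
  then have "is_hyperplane (diagonal i l)"
    unfolding is_hyperplane_def using complex_functional_diagonal
    by (intro exI[of _ "\<lambda>v. v $ i - v $ l"]) (auto simp: diagonal_def)
  then show ?thesis
    unfolding reflection_hyperplanes_def using swap_in_Gp[OF assms(1)] fixed_space_swap[of i l] by auto
qed

text \<open>
  Basis vectors detect fixed indices, so \<open>g\<close> fixes every index other than \<open>i\<close> and \<open>l\<close> and moves
  these two. Hence the element \<open>sigma_H\<close>, a mere choice of an element with the given fixed space, is
  the transposition.
\<close>

lemma fixed_space_diagonal_imp_swap:
  assumes "i \<noteq> l" "fixed_space g = diagonal i l"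
  shows "Perm.apply g = Transposition.transpose i l"
proof -
  have fix_iff: "Perm.apply g m = m \<longleftrightarrow> m \<noteq> i \<and> m \<noteq> l" for m
  proof -
    have "Perm.apply g m = m \<longleftrightarrow> (axis m 1 :: complex ^ 'a) \<in> fixed_space g"
      by (simp add: fixed_space_def vact_axis axis_eq_axis)
    then show ?thesis using assms by (simp add: axis_in_diagonal_iff)
  qed
  have inj: "Perm.apply g m = Perm.apply g m' \<longleftrightarrow> m = m'" for m m'
    using apply_inj by (metis injD)
  have "Perm.apply g (Perm.apply g m) = Perm.apply g m \<longleftrightarrow> Perm.apply g m = m" for m
    by (simp only: inj)
  then have "Perm.apply g i \<in> {i, l} - {i}" "Perm.apply g l \<in> {i, l} - {l}"
    using fix_iff by blast+
  then show ?thesis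
    using fix_iff assms(1) by (auto simp: fun_eq_iff Transposition.transpose_def)
qed

lemma a_H_diagonal:
  assumes "l \<in> block lab i" "l \<noteq> i"
  shows "a_H lab sign_char (diagonal i l) = 1"
proof -
  define \<sigma> where "\<sigma> = sigma_H lab (diagonal i l)"
  have "\<sigma> \<in> Gp lab \<and> fixed_space \<sigma> = diagonal i l"
    unfolding \<sigma>_def sigma_H_def
    by (rule someI[of _ "Perm.swap i l"]) (simp add: swap_in_Gp assms fixed_space_swap)
  then have "Perm.apply \<sigma> = Transposition.transpose i l"
    using fixed_space_diagonal_imp_swap assms(2) by metis
  then have \<sigma>: "sign_char \<sigma> = -1" using assms(2) by (simp add: sign_char_def sign_swap_id)
  have "(LEAST a. (-1 :: complex) = (-1) ^ a) = 1"
  proof (rule Least_equality)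
    show "1 \<le> b" if "(-1 :: complex) = (-1) ^ b" for b
      using that by (cases b) auto
  qed simp
  then show ?thesis unfolding a_H_def det_vact \<sigma>_def[symmetric] \<sigma> .
qed

lemma gamma_H_hyperplane:
  assumes "is_hyperplane H"
  shows "complex_functional (gamma_H H)" "{v. gamma_H H v = 0} = H"
proof -
  have "\<exists>\<gamma>. complex_functional \<gamma> \<and> {v. \<gamma> v = 0} = H"
    using assms unfolding is_hyperplane_def by blast
  then have "complex_functional (gamma_H H) \<and> {v. gamma_H H v = 0} = H"
    unfolding gamma_H_def by (rule someI_ex)
  then show "complex_functional (gamma_H H)" "{v. gamma_H H v = 0} = H" by auto
qed

text \<open>
  \<open>gamma_H\<close> is determined up to a scalar; subtracting \<open>v\<^sub>i - v\<^sub>l\<close> times the \<open>i\<close>-th basis vector moves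
  \<open>v\<close> into the hyperplane, which identifies this scalar as the value at the basis vector.
\<close>

lemma functional_with_diagonal_kernel:
  fixes \<gamma> :: "complex ^ 'i::finite \<Rightarrow> complex"
  assumes "complex_functional \<gamma>" "{v. \<gamma> v = 0} = diagonal i l" "i \<noteq> l"
  shows "\<gamma> v = \<gamma> (axis i 1) * (v $ i - v $ l)"
proof -
  have lin: "\<gamma> (x + y) = \<gamma> x + \<gamma> y" "\<gamma> (c *s x) = c * \<gamma> x" for x y c
    using assms(1) by (auto simp: complex_functional_iff)
  define w where "w = v + (- (v $ i - v $ l)) *s axis i 1"
  have "w \<in> diagonal i l" using assms(3) by (simp add: w_def diagonal_def axis_def)
  then have "\<gamma> w = 0" using assms(2) by auto
  then show ?thesis unfolding w_def lin by (simp add: algebra_simps)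
qed

lemma is_hyperplane_reflection: "H \<in> reflection_hyperplanes lab \<Longrightarrow> is_hyperplane H"
  by (auto simp: reflection_hyperplanes_def)

lemma poly_funs_gamma_H: "H \<in> reflection_hyperplanes lab \<Longrightarrow> gamma_H H \<in> poly_funs"
  by (intro poly_funs_functional gamma_H_hyperplane is_hyperplane_reflection)

lemma poly_funs_d_char: "d_char lab ch \<in> poly_funs"
  unfolding d_char_def[abs_def] by (intro poly_funs_prod poly_funs_power poly_funs_gamma_H)

text \<open>
  For the sign character every hyperplane \<open>z\<^sub>i = z\<^sub>l\<close> with \<open>l\<close> in the block of \<open>i\<close> enters with exponent
  one, and different \<open>l\<close> give different hyperplanes. So the denominator of the \<open>i\<close>-th coefficients
  divides \<open>d_char\<close>.
\<close>

lemma d_char_sign_factor: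
  obtains E where "E \<in> poly_funs"
    "\<And>z. d_char lab sign_char z = E z * (\<Prod>l\<in>block lab i - {i}. z $ i - z $ l)"
proof -
  let ?R = "reflection_hyperplanes lab"
  define B where "B = block lab i - {i}"
  define F where "F = diagonal i ` B"
  have fin: "finite ?R"
    by (rule finite_subset[of _ "fixed_space ` Gp lab"])
       (auto simp: reflection_hyperplanes_def finite_perm)
  have sub: "F \<subseteq> ?R" by (auto simp: F_def B_def intro: diagonal_in_reflection_hyperplanes)
  have inj: "inj_on (diagonal i) B"
  proof (rule inj_onI)
    fix l l' assume *: "l \<in> B" "l' \<in> B" "diagonal i l = diagonal i l'"
    then have "axis l' 1 \<notin> diagonal i l" using axis_in_diagonal_iff[of i l' l'] by (auto simp: B_def)
    then show "l = l'" using * axis_in_diagonal_iff[of i l l'] by (auto simp: B_def)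
  qed
  define c where "c l = gamma_H (diagonal i l) (axis i 1)" for l
  \<comment> \<open>The remaining hyperplanes and the scalars by which \<open>gamma_H\<close> differs from \<open>z\<^sub>i - z\<^sub>l\<close>.\<close>
  define E where "E z = (\<Prod>H\<in>?R - F. gamma_H H z ^ a_H lab sign_char H) * (\<Prod>l\<in>B. c l)" for z
  have "E \<in> poly_funs"
    unfolding E_def[abs_def]
    by (intro poly_funs.mult poly_funs_prod poly_funs_power poly_funs.const poly_funs_gamma_H[of _ lab]) auto
  moreover have "d_char lab sign_char z = E z * (\<Prod>l\<in>B. z $ i - z $ l)" for z
  proof -
    have "gamma_H (diagonal i l) z ^ a_H lab sign_char (diagonal i l) = c l * (z $ i - z $ l)"
      if "l \<in> B" for l
    proof -
      have l: "l \<in> block lab i" "l \<noteq> i" using that by (auto simp: B_def)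
      note H = is_hyperplane_reflection[OF diagonal_in_reflection_hyperplanes[OF l]]
      show ?thesis
        using functional_with_diagonal_kernel[OF gamma_H_hyperplane[OF H], of z] l
        by (simp add: a_H_diagonal c_def)
    qed
    then have "(\<Prod>H\<in>F. gamma_H H z ^ a_H lab sign_char H) = (\<Prod>l\<in>B. c l) * (\<Prod>l\<in>B. z $ i - z $ l)"
      unfolding F_def by (simp add: prod.reindex[OF inj] prod.distrib)
    then show ?thesis
      unfolding d_char_def prod.subset_diff[OF sub fin] E_def by simp
  qed
  ultimately show ?thesis unfolding B_def by (rule that)
qed

lemma d_char_times_coefficient_regular:
  fixes X :: "'i::finite skew"
  assumes pres: "skew_apply X ` O_total s lab \<subseteq> O_total s lab" and X: "axis_supported X"
    and mero: "Poly_Mapping.lookup X \<xi> \<in> mero_functions s"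
  shows "Mero (d_char lab sign_char) * Poly_Mapping.lookup X \<xi> \<in> regular_functions s"
proof (rule regular_functions_if_hol_germs)
  let ?d = "d_char lab sign_char" and ?f = "rep_mero (Poly_Mapping.lookup X \<xi>)"
  show "Mero ?d * Poly_Mapping.lookup X \<xi> \<in> mero_functions s"
    by (rule times_poly_mero_functions[OF poly_funs_d_char mero])
  fix y
  have "hol_germ y (\<lambda>z. ?d z * ?f z)"
  proof (cases "Poly_Mapping.lookup X \<xi> = 0")
    case True
    show ?thesis
      unfolding True by (rule hol_germ_mult[OF hol_germ_poly_funs[OF poly_funs_d_char] hol_germ_zero_mero])
  next
    case False
    then obtain i a where \<xi>: "\<xi> = axis i a" using X by (auto simp: axis_supported_def)
    obtain E where E: "E \<in> poly_funs"
      "\<And>z. ?d z = E z * (\<Prod>l\<in>block lab i - {i}. z $ i - z $ l)"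
      using d_char_sign_factor by blast
    have "hol_germ y (\<lambda>z. E z * (?f z * (\<Prod>l\<in>block lab i - {i}. z $ i - z $ l)))"
      unfolding \<xi> by (rule hol_germ_mult[OF hol_germ_poly_funs[OF E(1)] hol_germ_coefficient[OF pres X]])
    then show ?thesis by (simp add: E(2) mult_ac)
  qed
  then show "hol_germ y (rep_mero (Mero ?d * Poly_Mapping.lookup X \<xi>))"
    by (rule hol_germ_cong[OF _ agree_near_sym[OF rep_times_poly[OF poly_funs_d_char]]])
qed


section \<open>Standard elements and generators\<close>

lemma axis_supported_sum:
  assumes "\<And>Y. Y \<in> T \<Longrightarrow> axis_supported (u Y)" shows "axis_supported (\<Sum>Y\<in>T. u Y)"
  unfolding axis_supported_def
proof (intro allI impI)
  fix \<xi> assume "Poly_Mapping.lookup (\<Sum>Y\<in>T. u Y) \<xi> \<noteq> 0"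
  then obtain Y where "Y \<in> T" "Poly_Mapping.lookup (u Y) \<xi> \<noteq> 0"
    unfolding lookup_sum by (rule sum.not_neutral_contains_not_neutral)
  then show "\<exists>i a. \<xi> = axis i a" using assms by (auto simp: axis_supported_def)
qed

lemma axis_supported_scale: "axis_supported X \<Longrightarrow> axis_supported (skew_scale c X)"
  by (auto simp: axis_supported_def skew_scale_def Poly_Mapping.map.rep_eq when_def split: if_splits)

lemma axis_supported_single: "axis_supported (Poly_Mapping.single (axis i a) f)"
  by (auto simp: axis_supported_def lookup_single when_def split: if_splits)

lemma axis_supported_skew_act:
  assumes "axis_supported X" shows "axis_supported (skew_act g X)"
  unfolding skew_act_def
proof (rule axis_supported_sum)
  fix \<xi> assume "\<xi> \<in> Poly_Mapping.keys X"
  then obtain i a where "\<xi> = axis i a" using assms by (auto simp: axis_supported_def in_keys_iff)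
  then show "axis_supported (Poly_Mapping.single (vact g \<xi>) (mact g (Poly_Mapping.lookup X \<xi>)))"
    by (simp add: vact_axis axis_supported_single)
qed

lemma xi_eq_axis:
  assumes "inj lab" shows "\<exists>i b. xi lab k a = axis i b"
proof (cases "\<exists>i. lab i = (k, 1)")
  case True
  then obtain i where "lab i = (k, 1)" by blast
  then have "lab j = (k, 1) \<longleftrightarrow> j = i" for j using assms by (metis injD)
  then have "xi lab k a = axis i a" by (simp add: xi_def delta1_def vec_eq_iff axis_def)
  then show ?thesis by blast
next
  case False
  \<comment> \<open>If there is no coordinate \<open>(k, 1)\<close>, then \<open>xi\<close> is zero, the null multiple of any basis vector.\<close>
  then have "xi lab k a = axis undefined 0" by (simp add: xi_def delta1_def vec_eq_iff axis_def)
  then show ?thesis by blast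
qed

lemma axis_supported_standard_combination:
  assumes "inj lab" "X \<in> standard_combinations s n lab" shows "axis_supported X"
proof -
  have standard: "axis_supported Y" if Y_std: "standard_element s n lab Y" for Y
  proof -
    obtain a k f where Y: "Y = (\<Sum>g\<in>Gp lab. skew_act g (Poly_Mapping.single (xi lab k a) f))"
      using Y_std unfolding standard_element_def by blast
    obtain i b where "xi lab k a = axis i b" using xi_eq_axis[OF assms(1)] by blast
    then show ?thesis
      unfolding Y by (simp add: axis_supported_sum axis_supported_skew_act axis_supported_single)
  qed
  obtain T c where "X = (\<Sum>Y\<in>T. skew_scale (c Y) Y)" "\<forall>Y\<in>T. standard_element s n lab Y"
    using assms(2) unfolding standard_combinations_def by blast
  then show ?thesis by (simp add: axis_supported_sum axis_supported_scale standard)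
qed

lemma skew_subalgebra_hull: "skew_subalgebra (skew_subalgebra hull S)"
  by (rule hull_in) (auto simp: skew_subalgebra_def)

lemma skew_subalgebra_hull_least:
  "S \<subseteq> skew_subalgebra hull S' \<Longrightarrow> skew_subalgebra hull S \<subseteq> skew_subalgebra hull S'"
  by (rule hull_minimal) (simp_all add: skew_subalgebra_hull)

lemma skew_subalgebra_hull_closed:
  "skew_one \<in> skew_subalgebra hull S"
  "X \<in> skew_subalgebra hull S \<Longrightarrow> Y \<in> skew_subalgebra hull S \<Longrightarrow> X + Y \<in> skew_subalgebra hull S"
  "X \<in> skew_subalgebra hull S \<Longrightarrow> skew_scale c X \<in> skew_subalgebra hull S"
  "X \<in> skew_subalgebra hull S \<Longrightarrow> Y \<in> skew_subalgebra hull S \<Longrightarrow>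
    skew_mult X Y \<in> skew_subalgebra hull S"
  using skew_subalgebra_hull[of S] unfolding skew_subalgebra_def[of "_ hull _"] by simp_all

lemma hull_finitely_generated_element:
  assumes "x \<in> skew_subalgebra hull L"
  shows "\<exists>L0. finite L0 \<and> L0 \<subseteq> L \<and> x \<in> skew_subalgebra hull L0"
proof -
  define Q where "Q x \<longleftrightarrow> (\<exists>L0. finite L0 \<and> L0 \<subseteq> L \<and> x \<in> skew_subalgebra hull L0)" for x
  have QI: "Q x" if "finite L0" "L0 \<subseteq> L" "x \<in> skew_subalgebra hull L0" for x L0
    unfolding Q_def using that by blast
  have joint: "\<exists>L0. finite L0 \<and> L0 \<subseteq> L \<and> x \<in> skew_subalgebra hull L0 \<and> y \<in> skew_subalgebra hull L0"
    if xy: "Q x" "Q y" for x y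
  proof -
    obtain L1 L2 where L12: "finite L1" "L1 \<subseteq> L" "x \<in> skew_subalgebra hull L1"
      "finite L2" "L2 \<subseteq> L" "y \<in> skew_subalgebra hull L2" using xy unfolding Q_def by blast
    then show ?thesis
      using hull_mono[of L1 "L1 \<union> L2" skew_subalgebra] hull_mono[of L2 "L1 \<union> L2" skew_subalgebra]
      by (intro exI[of _ "L1 \<union> L2"]) auto
  qed
  have one: "Q skew_one"
    by (rule QI[of "{}"]) (simp_all add: skew_subalgebra_hull_closed)
  have add: "Q (X + Y)" and mult: "Q (skew_mult X Y)" if XY: "Q X" "Q Y" for X Y
  proof -
    obtain L0 where "finite L0" "L0 \<subseteq> L" "X \<in> skew_subalgebra hull L0" "Y \<in> skew_subalgebra hull L0"
      using joint[OF XY] by blast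
    then show "Q (X + Y)" "Q (skew_mult X Y)" by (blast intro: QI skew_subalgebra_hull_closed)+
  qed
  have scale: "Q (skew_scale c X)" if X: "Q X" for c X
  proof -
    obtain L0 where "finite L0" "L0 \<subseteq> L" "X \<in> skew_subalgebra hull L0"
      using joint[OF X X] by blast
    then show ?thesis by (blast intro: QI skew_subalgebra_hull_closed)
  qed
  have "Q x"
    using assms
  proof (rule hull_induct)
    show "Q x" if "x \<in> L" for x using that by (intro QI[of "{x}"]) (auto intro: hull_inc)
    show "skew_subalgebra {x. Q x}"
      by (simp add: skew_subalgebra_def one add scale mult)
  qed
  then show ?thesis by (simp only: Q_def)
qed

text \<open>
  A given finite set \<open>T\<close> of generators over \<open>I\<close> may contain elements that are not combinations of
  standard ones. But each of its members is an algebraic expression in finitely many elements of \<open>L\<close>,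
  and all these elements together can take the place of \<open>T\<close>.
\<close>

lemma finite_set_of_standard_generators:
  assumes "I \<subseteq> skew_subalgebra hull L" "finite T"
    and gen: "skew_subalgebra hull L = skew_subalgebra hull (I \<union> T)"
  obtains L0 where "finite L0" "L0 \<subseteq> L" "skew_subalgebra hull L = skew_subalgebra hull (I \<union> L0)"
proof -
  have "\<forall>x\<in>T. \<exists>L0. finite L0 \<and> L0 \<subseteq> L \<and> x \<in> skew_subalgebra hull L0"
  proof
    fix x assume "x \<in> T"
    then have "x \<in> skew_subalgebra hull L" unfolding gen by (intro hull_inc) simp
    then show "\<exists>L0. finite L0 \<and> L0 \<subseteq> L \<and> x \<in> skew_subalgebra hull L0"
      by (rule hull_finitely_generated_element)
  qed
  then obtain u where u: "\<And>x. x \<in> T \<Longrightarrow> finite (u x) \<and> u x \<subseteq> L \<and> x \<in> skew_subalgebra hull u x"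
    by metis
  define L0 where "L0 = (\<Union>x\<in>T. u x)"
  have L0: "finite L0" "L0 \<subseteq> L" using u assms(2) by (auto simp: L0_def)
  have "x \<in> skew_subalgebra hull (I \<union> L0)" if "x \<in> T" for x
  proof -
    have "u x \<subseteq> I \<union> L0" using that by (auto simp: L0_def)
    from subsetD[OF hull_mono[OF this]] show ?thesis using u[OF that] by simp
  qed
  then have "I \<union> T \<subseteq> skew_subalgebra hull (I \<union> L0)"
    using hull_subset[of "I \<union> L0" skew_subalgebra] by blast
  then have "skew_subalgebra hull L \<subseteq> skew_subalgebra hull (I \<union> L0)"
    unfolding gen by (rule skew_subalgebra_hull_least)
  moreover have "I \<union> L0 \<subseteq> skew_subalgebra hull L"
    using assms(1) L0(2) hull_subset[of L skew_subalgebra] by blast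
  then have "skew_subalgebra hull (I \<union> L0) \<subseteq> skew_subalgebra hull L"
    by (rule skew_subalgebra_hull_least)
  ultimately show ?thesis using that[OF L0] by blast
qed

theorem corollary21:
  fixes n :: nat and N :: "nat \<Rightarrow> nat" and lab :: "'i::finite \<Rightarrow> nat \<times> nat"
    and s :: setting and A :: "'i skew set"
  assumes "n \<ge> 2"
    and "\<forall>k\<in>{1..n}. N k \<ge> 1"
    and "labelling n N lab"
    and "standard_type_A s n lab A"
    and "fin_gen_over_invariants s lab A"
    and "preserves_O s lab A"
  shows "rational_galois_order s lab A"
proof -
  have "inj lab" using assms(3) by (simp add: labelling_def bij_betw_def)
  obtain L where inv: "A \<subseteq> skew_invariants s lab" and L: "L \<subseteq> standard_combinations s n lab"
    and A: "A = skew_subalgebra hull L"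
    using assms(4) unfolding standard_type_A_def by blast
  obtain T where I: "invariant_functions s lab \<subseteq> A" and T: "finite T"
    "A = skew_subalgebra hull (invariant_functions s lab \<union> T)"
    using assms(5) unfolding fin_gen_over_invariants_def by blast
  obtain L0 where L0: "finite L0" "L0 \<subseteq> L"
    "A = skew_subalgebra hull (invariant_functions s lab \<union> L0)"
    by (rule finite_set_of_standard_generators[of "invariant_functions s lab" L T])
       (use I T in \<open>simp_all add: A\<close>)
  have "L0 \<subseteq> A" unfolding L0(3) by (rule order.trans[OF _ hull_subset]) simp
  have "Mero (d_char lab sign_char) * Poly_Mapping.lookup X \<xi> \<in> regular_functions s"
    if "X \<in> L0" for X \<xi>
  proof (rule d_char_times_coefficient_regular)
    show "skew_apply X ` O_total s lab \<subseteq> O_total s lab"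
      using assms(6) \<open>L0 \<subseteq> A\<close> that unfolding preserves_O_def by blast
    show "axis_supported X"
      using axis_supported_standard_combination[OF \<open>inj lab\<close>] L L0(2) that by blast
    show "Poly_Mapping.lookup X \<xi> \<in> mero_functions s"
      using inv \<open>L0 \<subseteq> A\<close> that unfolding skew_invariants_def by blast
  qed
  then have "\<exists>ch. is_character lab ch \<and>
      (\<forall>\<xi>. Mero (d_char lab ch) * Poly_Mapping.lookup X \<xi> \<in> regular_functions s)"
    if "X \<in> L0" for X
    using that is_character_sign_char by (intro exI[of _ sign_char]) simp
  moreover have "L0 \<subseteq> skew_invariants s lab" using \<open>L0 \<subseteq> A\<close> inv by (rule order.trans)
  ultimately show ?thesis
    unfolding rational_galois_order_def
    by (intro conjI inv I exI[of _ L0] L0(1,3) ballI)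
qed

end
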